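(* Let $0<a\le 1$ and let $z_1,z_2\in\mathbb{C}$ with $0<|z_1|,|z_2|\le 1$. Let $\Phi_2(s_1,s_2,a,z_1,z_2)$ denote the Hurwitz-Lerch type of Euler-Zagier double zeta function (meromorphically continued in $(s_1,s_2)$), and let $\sigma_1,\sigma_2$ denote real numbers. (1) Let $z_1=z_2=1$. Then $\Phi_2(\sigma_1,\sigma_2,a,1,1)\ne 0$ for all $(\sigma_1,\sigma_2)$ with $0<\sigma_1<1$, $\sigma_2>1$ and $1<\sigma_1+\sigma_2<2$ if and only if $a\ge 1/2$. (2) Let $z_1=1$ and $z_2\ne 1$. Then $\Phi_2(\sigma_1,\sigma_2,a,1,z_2)\neq 0$ for all $\sigma_1>1$, $\sigma_2>0$ and $0<a\le 1$. (3) Let $z_1\neq 1$ and $z_2=1$. Then $\Phi_2(\sigma_1,\sigma_2,a,z_1,1)\neq 0$ for all $\sigma_1>0$, $\sigma_2>1$ and $0<a\le 1$. (4) Let $z_1\ne 1$ and $z_2\neq 1$. Then $\Phi_2(\sigma_1,\sigma_2,a,z_1,z_2)\ne 0$ for all $\sigma_1>0$, $\sigma_2>0$ and $0<a\le 1$.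
   Context: For $0<a\le 1$, $s_1,s_2\in\mathbb{C}$ and $z_1,z_2\in\mathbb{C}$ with $0<|z_1|,|z_2|\le 1$, the Hurwitz-Lerch type of Euler-Zagier double zeta function is defined by $$\Phi_2(s_1,s_2,a,z_1,z_2):=\sum_{m=0}^\infty\frac{z_1^m}{(m+a)^{s_1}}\sum_{n=1}^\infty\frac{z_2^{n-1}}{(m+n+a)^{s_2}},$$ where the series converges absolutely (for instance for $\Re(s_1)>1$, $\Re(s_2)>1$). For fixed $a,z_1,z_2$ it is continued meromorphically in $(s_1,s_2)$ to the whole of $\mathbb{C}^2$; outside the region of convergence, $\Phi_2$ denotes this continuation. *)

theory Defs
  imports "HOL-Complex_Analysis.Complex_Analysis"
begin

section \<open>Meromorphic functions of two complex variables\<close>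

definition holomorphic2_on :: "(complex \<times> complex \<Rightarrow> complex) \<Rightarrow> (complex \<times> complex) set \<Rightarrow> bool"
  (infixl "holomorphic2'_on" 50) where
  "F holomorphic2_on U \<longleftrightarrow>
     (\<forall>p\<in>U. \<exists>c d. (F has_derivative (\<lambda>(h, k). c * h + d * k)) (at p))"

text \<open>Locally a quotient of holomorphic functions whose denominator vanishes identically on no
  nonempty open set.  No condition is put on the value of \<open>F\<close> where the denominator is zero.\<close>

definition meromorphic2_on :: "(complex \<times> complex \<Rightarrow> complex) \<Rightarrow> (complex \<times> complex) set \<Rightarrow> bool"
  (infixl "meromorphic2'_on" 50) where
  "F meromorphic2_on U \<longleftrightarrow>
     (\<forall>p\<in>U. \<exists>V g h. open V \<and> p \<in> V \<and> g holomorphic2_on V \<and> h holomorphic2_on V \<and>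
        V \<subseteq> closure {q \<in> V. h q \<noteq> 0} \<and> (\<forall>q\<in>V. h q \<noteq> 0 \<longrightarrow> F q = g q / h q))"

section \<open>The double zeta function\<close>

text \<open>The inner summation index is \<open>n - 1\<close>, so that it starts at \<open>0\<close>.\<close>

definition Phi2_series :: "complex \<Rightarrow> complex \<Rightarrow> real \<Rightarrow> complex \<Rightarrow> complex \<Rightarrow> complex" where
  "Phi2_series s1 s2 a z1 z2 =
     (\<Sum>m. z1 ^ m / of_real (real m + a) powr s1 *
        (\<Sum>n. z2 ^ n / of_real (real m + real (Suc n) + a) powr s2))"

definition Phi2_conv :: "(complex \<times> complex) set" where
  "Phi2_conv = {(s1, s2). Re s1 > 1 \<and> Re s2 > 1}"

text \<open>\<open>v\<close> is the value at \<open>(s1, s2)\<close> of a meromorphic continuation of the series that is regular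
  at \<open>(s1, s2)\<close>.  The continuation may live on any convex open set, in particular on the whole
  space.  The value does not depend on the choice, because the intersection of two convex domains
  is convex and so connected; see \<open>Phi2_eqI\<close> below, which for \<open>U = UNIV\<close> says
  that \<open>Phi2\<close> is the continuation to the whole space at each point where that is regular.\<close>

definition Phi2_value :: "complex \<Rightarrow> complex \<Rightarrow> real \<Rightarrow> complex \<Rightarrow> complex \<Rightarrow> complex \<Rightarrow> bool" where
  "Phi2_value s1 s2 a z1 z2 v \<longleftrightarrow>
     (\<exists>U F W. open U \<and> convex U \<and> Phi2_conv \<subseteq> U \<and> F meromorphic2_on U \<and>
        (\<forall>(w1, w2) \<in> Phi2_conv. F (w1, w2) = Phi2_series w1 w2 a z1 z2) \<and>
        open W \<and> W \<subseteq> U \<and> (s1, s2) \<in> W \<and> F holomorphic2_on W \<and> F (s1, s2) = v)"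

text \<open>The value is \<open>0\<close> by convention at points where no continuation is regular, so
  \<open>Phi2 s1 s2 a z1 z2 \<noteq> 0\<close> entails that the continuation is regular at \<open>(s1, s2)\<close>.\<close>

definition Phi2 :: "complex \<Rightarrow> complex \<Rightarrow> real \<Rightarrow> complex \<Rightarrow> complex \<Rightarrow> complex" where
  "Phi2 s1 s2 a z1 z2 =
     (if \<exists>v. Phi2_value s1 s2 a z1 z2 v then THE v. Phi2_value s1 s2 a z1 z2 v else 0)"

section \<open>The value of the continuation is well defined\<close>

lemma holomorphic2_on_subset: "F holomorphic2_on U \<Longrightarrow> V \<subseteq> U \<Longrightarrow> F holomorphic2_on V"
  unfolding holomorphic2_on_def by blast

lemma holomorphic2_on_imp_continuous_on: "F holomorphic2_on U \<Longrightarrow> continuous_on U F"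
  unfolding holomorphic2_on_def
  by (meson continuous_at_imp_continuous_on has_derivative_continuous)

lemma holomorphic2_on_mult:
  assumes "F holomorphic2_on U" "G holomorphic2_on U"
  shows "(\<lambda>p. F p * G p) holomorphic2_on U"
  unfolding holomorphic2_on_def
proof
  fix p assume "p \<in> U"
  then obtain c d c' d' where
    F: "(F has_derivative (\<lambda>(h, k). c * h + d * k)) (at p)" and
    G: "(G has_derivative (\<lambda>(h, k). c' * h + d' * k)) (at p)"
    using assms unfolding holomorphic2_on_def by meson
  have "((\<lambda>p. F p * G p) has_derivative
          (\<lambda>(h, k). (F p * c' + c * G p) * h + (F p * d' + d * G p) * k)) (at p)"
    by (rule has_derivative_eq_rhs[OF has_derivative_mult[OF F G]])
       (auto simp: fun_eq_iff algebra_simps)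
  then show "\<exists>c d. ((\<lambda>p. F p * G p) has_derivative (\<lambda>(h, k). c * h + d * k)) (at p)"
    by blast
qed

lemma holomorphic2_on_diff:
  assumes "F holomorphic2_on U" "G holomorphic2_on U"
  shows "(\<lambda>p. F p - G p) holomorphic2_on U"
  unfolding holomorphic2_on_def
proof
  fix p assume "p \<in> U"
  then obtain c d c' d' where
    F: "(F has_derivative (\<lambda>(h, k). c * h + d * k)) (at p)" and
    G: "(G has_derivative (\<lambda>(h, k). c' * h + d' * k)) (at p)"
    using assms unfolding holomorphic2_on_def by meson
  have "((\<lambda>p. F p - G p) has_derivative (\<lambda>(h, k). (c - c') * h + (d - d') * k)) (at p)"
    by (rule has_derivative_eq_rhs[OF has_derivative_diff[OF F G]])
       (auto simp: fun_eq_iff algebra_simps)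
  then show "\<exists>c d. ((\<lambda>p. F p - G p) has_derivative (\<lambda>(h, k). c * h + d * k)) (at p)"
    by blast
qed

lemma holomorphic2_on_line:
  assumes "F holomorphic2_on U"
  shows "(\<lambda>t. F (u1 + t * v1, u2 + t * v2)) holomorphic_on {t. (u1 + t * v1, u2 + t * v2) \<in> U}"
proof -
  have "\<exists>D. ((\<lambda>t. F (u1 + t * v1, u2 + t * v2)) has_field_derivative D) (at t)"
    if t: "(u1 + t * v1, u2 + t * v2) \<in> U" for t
  proof -
    obtain c d where F: "(F has_derivative (\<lambda>(h, k). c * h + d * k)) (at (u1 + t * v1, u2 + t * v2))"
      using assms t unfolding holomorphic2_on_def by meson
    have L: "((\<lambda>t. (u1 + t * v1, u2 + t * v2)) has_derivative (\<lambda>h. (h * v1, h * v2))) (at t)"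
      by (auto intro!: derivative_eq_intros)
    have "((\<lambda>t. F (u1 + t * v1, u2 + t * v2)) has_derivative (*) (c * v1 + d * v2)) (at t)"
      by (rule has_derivative_eq_rhs[OF has_derivative_compose[OF L F]])
         (auto simp: fun_eq_iff algebra_simps)
    then show ?thesis
      unfolding has_field_derivative_def by blast
  qed
  then show ?thesis
    unfolding holomorphic_on_def field_differentiable_def
    using has_field_derivative_at_within by blast
qed

lemma holomorphic2_identity:
  assumes F: "F holomorphic2_on U" and U: "open U" "convex U"
    and W: "open W" "W \<subseteq> U" "W \<noteq> {}" "\<And>p. p \<in> W \<Longrightarrow> F p = 0" and q: "q \<in> U"
  shows "F q = 0"
proof -
  obtain u1 u2 where u: "(u1, u2) \<in> W"
    using W(3) by auto
  obtain q1 q2 where q12: "q = (q1, q2)"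
    by (cases q)
  define l where "l = (\<lambda>t. (u1 + t * (q1 - u1), u2 + t * (q2 - u2)))"
  have l_cont: "continuous_on A l" for A
    unfolding l_def by (intro continuous_intros)
  have lin: "l (x *\<^sub>R s + y *\<^sub>R t) = x *\<^sub>R l s + y *\<^sub>R l t" if "x + y = 1" for x y :: real and s t
  proof -
    have y: "y = 1 - x" using that by simp
    show ?thesis
      unfolding l_def y by (simp add: scaleR_conv_of_real algebra_simps)
  qed
  have "convex (l -` U)"
    using U(2) unfolding convex_def by (auto simp: lin)
  then have conn: "connected (l -` U)"
    by (rule convex_connected)
  have "open (l -` U)" "open (l -` W)"
    using U(1) W(1) l_cont[of UNIV] by (auto intro: open_vimage)
  moreover have "(\<lambda>t. F (l t)) holomorphic_on l -` U"
    using holomorphic2_on_line[OF F] unfolding l_def vimage_def .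
  moreover have "0 \<in> l -` W"
    using u by (simp add: l_def)
  moreover have "1 \<in> l -` U"
    using q by (simp add: l_def q12)
  ultimately have "F (l 1) = 0"
    using analytic_continuation_open[of "l -` W" "l -` U" "\<lambda>t. F (l t)" "\<lambda>_. 0" 1] conn W(2,4)
    by auto
  then show ?thesis
    by (simp add: l_def q12)
qed

lemma open_nonzero:
  fixes F :: "'a::topological_space \<Rightarrow> complex"
  assumes "open U" "continuous_on U F"
  shows "open {x \<in> U. F x \<noteq> 0}"
proof -
  have "open (U \<inter> F -` (- {0}))"
    using assms by (intro continuous_open_preimage) auto
  also have "U \<inter> F -` (- {0}) = {x \<in> U. F x \<noteq> 0}"
    by auto
  finally show ?thesis .
qed

lemma meromorphic2_unique_aux:
  assumes F: "F meromorphic2_on U" and G: "G meromorphic2_on U" and U: "open U" "convex U"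
    and D: "open D" "D \<noteq> {}" "D \<subseteq> U" "\<And>p. p \<in> D \<Longrightarrow> F p = G p"
  shows "U \<subseteq> interior (closure (interior {p. F p = G p}))"
proof -
  define E where "E = interior (closure (interior {p. F p = G p}))"
  have ball: "ball q r \<subseteq> E" if q: "q \<in> U \<inter> closure E" and r: "r > 0" and
      g1: "g1 holomorphic2_on ball q r" and h1: "h1 holomorphic2_on ball q r" and
      d1: "ball q r \<subseteq> closure {x \<in> ball q r. h1 x \<noteq> 0}" and
      F1: "\<And>x. x \<in> ball q r \<Longrightarrow> h1 x \<noteq> 0 \<Longrightarrow> F x = g1 x / h1 x" and
      g2: "g2 holomorphic2_on ball q r" and h2: "h2 holomorphic2_on ball q r" and
      d2: "ball q r \<subseteq> closure {x \<in> ball q r. h2 x \<noteq> 0}" and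
      G2: "\<And>x. x \<in> ball q r \<Longrightarrow> h2 x \<noteq> 0 \<Longrightarrow> G x = g2 x / h2 x"
    for q r g1 h1 g2 h2
  proof -
    let ?B = "ball q r"
    define N where "N = {x \<in> ?B. h1 x \<noteq> 0} \<inter> {x \<in> ?B. h2 x \<noteq> 0}"
    have o1: "open {x \<in> ?B. h1 x \<noteq> 0}"
      by (rule open_nonzero[OF open_ball holomorphic2_on_imp_continuous_on[OF h1]])
    have o2: "open {x \<in> ?B. h2 x \<noteq> 0}"
      by (rule open_nonzero[OF open_ball holomorphic2_on_imp_continuous_on[OF h2]])
    have N: "open N"
      unfolding N_def using o1 o2 by blast
    have meets: "A \<inter> N \<noteq> {}" if A: "open A" "A \<inter> ?B \<noteq> {}" for A
    proof -
      have "A \<inter> {x \<in> ?B. h1 x \<noteq> 0} \<noteq> {}"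
        using open_Int_closure_eq_empty[OF A(1)] A(2) d1 by blast
      then have "(A \<inter> {x \<in> ?B. h1 x \<noteq> 0}) \<inter> closure {x \<in> ?B. h2 x \<noteq> 0} \<noteq> {}"
        using d2 by blast
      then show ?thesis
        using open_Int_closure_eq_empty[OF open_Int[OF A(1) o1]] unfolding N_def by blast
    qed
    have dense: "?B \<subseteq> closure N"
    proof
      fix x assume x: "x \<in> ?B"
      show "x \<in> closure N"
      proof (rule ccontr)
        assume "x \<notin> closure N"
        with x have "- closure N \<inter> ?B \<noteq> {}"
          by blast
        then have "- closure N \<inter> N \<noteq> {}"
          by (intro meets) auto
        then show False
          using closure_subset[of N] by blast
      qed
    qed
    define A where "A = interior {p. F p = G p} \<inter> N"
    have "E \<inter> ?B \<noteq> {}"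
      using q r open_Int_closure_eq_empty[of ?B E] by (auto simp: Int_commute)
    then have "closure (interior {p. F p = G p}) \<inter> ?B \<noteq> {}"
      using interior_subset unfolding E_def by blast
    then have "interior {p. F p = G p} \<inter> ?B \<noteq> {}"
      using open_Int_closure_eq_empty[of ?B "interior {p. F p = G p}"] by (auto simp: Int_commute)
    then have A: "open A" "A \<noteq> {}" "A \<subseteq> ?B"
      using meets[of "interior {p. F p = G p}"] N unfolding A_def by (auto simp: N_def)
    have "(\<lambda>x. g1 x * h2 x - g2 x * h1 x) holomorphic2_on ?B"
      by (intro holomorphic2_on_diff holomorphic2_on_mult g1 g2 h1 h2)
    moreover have "g1 x * h2 x - g2 x * h1 x = 0" if "x \<in> A" for x
    proof -
      have "F x = G x" "x \<in> N"
        using that interior_subset unfolding A_def by blast+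
      then have "h1 x \<noteq> 0" "h2 x \<noteq> 0" "g1 x / h1 x = g2 x / h2 x"
        using F1[of x] G2[of x] by (auto simp: N_def)
      then show ?thesis
        by (simp add: field_simps)
    qed
    ultimately have "g1 x * h2 x - g2 x * h1 x = 0" if "x \<in> ?B" for x
      using holomorphic2_identity[of "\<lambda>x. g1 x * h2 x - g2 x * h1 x" ?B A x] A that by auto
    then have "g1 x / h1 x = g2 x / h2 x" if "x \<in> N" for x
      using that by (simp add: N_def field_simps)
    then have "N \<subseteq> {p. F p = G p}"
      using F1 G2 by (auto simp: N_def)
    then have "N \<subseteq> interior {p. F p = G p}"
      using N by (simp add: interior_maximal)
    then have "?B \<subseteq> closure (interior {p. F p = G p})"
      using dense closure_mono by blast
    then show "?B \<subseteq> E"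
      unfolding E_def by (simp add: interior_maximal)
  qed
  have clo: "U \<inter> closure E \<subseteq> E"
  proof
    fix q assume q: "q \<in> U \<inter> closure E"
    have "\<exists>V g h. open V \<and> q \<in> V \<and> g holomorphic2_on V \<and> h holomorphic2_on V \<and>
        V \<subseteq> closure {x \<in> V. h x \<noteq> 0} \<and> (\<forall>x\<in>V. h x \<noteq> 0 \<longrightarrow> F x = g x / h x)"
      using F q unfolding meromorphic2_on_def by blast
    then obtain V1 g1 h1 where V1: "open V1" "q \<in> V1" "g1 holomorphic2_on V1" "h1 holomorphic2_on V1"
      "V1 \<subseteq> closure {x \<in> V1. h1 x \<noteq> 0}" "\<And>x. x \<in> V1 \<Longrightarrow> h1 x \<noteq> 0 \<Longrightarrow> F x = g1 x / h1 x"
      by blast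
    have "\<exists>V g h. open V \<and> q \<in> V \<and> g holomorphic2_on V \<and> h holomorphic2_on V \<and>
        V \<subseteq> closure {x \<in> V. h x \<noteq> 0} \<and> (\<forall>x\<in>V. h x \<noteq> 0 \<longrightarrow> G x = g x / h x)"
      using G q unfolding meromorphic2_on_def by blast
    then obtain V2 g2 h2 where V2: "open V2" "q \<in> V2" "g2 holomorphic2_on V2" "h2 holomorphic2_on V2"
      "V2 \<subseteq> closure {x \<in> V2. h2 x \<noteq> 0}" "\<And>x. x \<in> V2 \<Longrightarrow> h2 x \<noteq> 0 \<Longrightarrow> G x = g2 x / h2 x"
      by blast
    obtain r where r: "r > 0" "ball q r \<subseteq> V1 \<inter> V2"
      using V1(1,2) V2(1,2) open_contains_ball[of "V1 \<inter> V2"] by (meson IntI open_Int)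
    have restrict: "ball q r \<subseteq> closure {x \<in> ball q r. h x \<noteq> 0}"
      if "V \<subseteq> closure {x \<in> V. h x \<noteq> 0}" "ball q r \<subseteq> V" for V and h :: "complex \<times> complex \<Rightarrow> complex"
    proof -
      have "ball q r \<subseteq> ball q r \<inter> closure {x \<in> V. h x \<noteq> 0}"
        using that by blast
      also have "\<dots> \<subseteq> closure (ball q r \<inter> {x \<in> V. h x \<noteq> 0})"
        by (rule open_Int_closure_subset) simp
      also have "\<dots> \<subseteq> closure {x \<in> ball q r. h x \<noteq> 0}"
        by (rule closure_mono) auto
      finally show ?thesis .
    qed
    have "ball q r \<subseteq> E"
    proof (rule ball[OF q r(1)])
      show "g1 holomorphic2_on ball q r" "h1 holomorphic2_on ball q r"
        "g2 holomorphic2_on ball q r" "h2 holomorphic2_on ball q r"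
        using V1(3,4) V2(3,4) r(2) holomorphic2_on_subset by blast+
      show "ball q r \<subseteq> closure {x \<in> ball q r. h1 x \<noteq> 0}"
        using restrict[OF V1(5)] r(2) by blast
      show "ball q r \<subseteq> closure {x \<in> ball q r. h2 x \<noteq> 0}"
        using restrict[OF V2(5)] r(2) by blast
      show "F x = g1 x / h1 x" if "x \<in> ball q r" "h1 x \<noteq> 0" for x
        using V1(6) that r(2) by blast
      show "G x = g2 x / h2 x" if "x \<in> ball q r" "h2 x \<noteq> 0" for x
        using V2(6) that r(2) by blast
    qed
    then show "q \<in> E"
      using r(1) by (auto dest: centre_in_ball[THEN iffD2])
  qed
  have "D \<subseteq> interior {p. F p = G p}"
    by (rule interior_maximal[OF _ D(1)]) (use D(4) in blast)
  then have "D \<subseteq> E"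
    unfolding E_def using D(1) by (meson closure_subset interior_maximal order_trans)
  then have "U \<inter> E \<noteq> {}"
    using D(2,3) by blast
  moreover have "openin (top_of_set U) (U \<inter> E)"
    unfolding E_def by (simp add: openin_open_Int)
  moreover have "closedin (top_of_set U) (U \<inter> E)"
  proof -
    have "U \<inter> E = U \<inter> closure E"
      using clo closure_subset by blast
    then show ?thesis
      by (simp add: closedin_closed_Int)
  qed
  moreover have "connected U"
    using U(2) by (rule convex_connected)
  ultimately have "U \<inter> E = U"
    unfolding connected_clopen by blast
  then show ?thesis
    unfolding E_def by blast
qed

lemma meromorphic2_unique:
  assumes "F meromorphic2_on U" "G meromorphic2_on U" "open U" "convex U"
    and "open D" "D \<noteq> {}" "D \<subseteq> U" "\<And>p. p \<in> D \<Longrightarrow> F p = G p"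
    and W: "open W" "W \<subseteq> U" "F holomorphic2_on W" "G holomorphic2_on W" and q: "q \<in> W"
  shows "F q = G q"
proof (rule ccontr)
  assume "F q \<noteq> G q"
  define N where "N = {x \<in> W. F x - G x \<noteq> 0}"
  have "continuous_on W (\<lambda>x. F x - G x)"
    using W(3,4) by (intro holomorphic2_on_imp_continuous_on holomorphic2_on_diff)
  then have N: "open N"
    unfolding N_def by (rule open_nonzero[OF W(1)])
  have "q \<in> N" "q \<in> U"
    using q W(2) \<open>F q \<noteq> G q\<close> by (auto simp: N_def)
  then have "q \<in> N \<inter> closure (interior {p. F p = G p})"
    using meromorphic2_unique_aux[OF assms(1-8)] interior_subset by blast
  then have "N \<inter> interior {p. F p = G p} \<noteq> {}"
    using open_Int_closure_eq_empty[OF N] by blast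
  then show False
    using interior_subset[of "{p. F p = G p}"] by (auto simp: N_def)
qed

lemma meromorphic2_on_subset: "F meromorphic2_on U \<Longrightarrow> V \<subseteq> U \<Longrightarrow> F meromorphic2_on V"
  unfolding meromorphic2_on_def by blast

lemma open_Phi2_conv: "open Phi2_conv"
proof -
  have "Phi2_conv = {s. Re s > 1} \<times> {s. Re s > 1}"
    by (auto simp: Phi2_conv_def)
  then show ?thesis
    by (metis open_Times open_halfspace_Re_gt)
qed

lemma Phi2_value_unique:
  assumes "Phi2_value s1 s2 a z1 z2 v" "Phi2_value s1 s2 a z1 z2 w"
  shows "v = w"
proof -
  obtain U F W where 1: "open U" "convex U" "Phi2_conv \<subseteq> U" "F meromorphic2_on U"
    "\<forall>(w1, w2) \<in> Phi2_conv. F (w1, w2) = Phi2_series w1 w2 a z1 z2"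
    "open W" "W \<subseteq> U" "(s1, s2) \<in> W" "F holomorphic2_on W" "F (s1, s2) = v"
    using assms(1) unfolding Phi2_value_def by (elim exE conjE) (rule that)
  obtain U' G W' where 2: "open U'" "convex U'" "Phi2_conv \<subseteq> U'" "G meromorphic2_on U'"
    "\<forall>(w1, w2) \<in> Phi2_conv. G (w1, w2) = Phi2_series w1 w2 a z1 z2"
    "open W'" "W' \<subseteq> U'" "(s1, s2) \<in> W'" "G holomorphic2_on W'" "G (s1, s2) = w"
    using assms(2) unfolding Phi2_value_def by (elim exE conjE) (rule that)
  have "F (s1, s2) = G (s1, s2)"
  proof (rule meromorphic2_unique[of F "U \<inter> U'" G Phi2_conv "W \<inter> W'"])
    show "F meromorphic2_on U \<inter> U'" "G meromorphic2_on U \<inter> U'"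
      using 1(4) 2(4) meromorphic2_on_subset by blast+
    show "F holomorphic2_on W \<inter> W'" "G holomorphic2_on W \<inter> W'"
      using 1(9) 2(9) holomorphic2_on_subset by blast+
    show "open (U \<inter> U')" "convex (U \<inter> U')" "open (W \<inter> W')"
      using 1(1,2,6) 2(1,2,6) by (simp_all add: open_Int convex_Int)
    show "Phi2_conv \<subseteq> U \<inter> U'" "W \<inter> W' \<subseteq> U \<inter> U'" "(s1, s2) \<in> W \<inter> W'"
      using 1(3,7,8) 2(3,7,8) by blast+
    have "(2, 2) \<in> Phi2_conv"
      by (simp add: Phi2_conv_def)
    then show "Phi2_conv \<noteq> {}"
      by blast
    show "F p = G p" if "p \<in> Phi2_conv" for p
      using bspec[OF 1(5) that] bspec[OF 2(5) that] by (cases p) simp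
  qed (rule open_Phi2_conv)
  then show ?thesis
    using 1(10) 2(10) by simp
qed

lemma Phi2_eqI:
  assumes "open U" "convex U" "Phi2_conv \<subseteq> U" "F meromorphic2_on U"
    and "\<And>w1 w2. (w1, w2) \<in> Phi2_conv \<Longrightarrow> F (w1, w2) = Phi2_series w1 w2 a z1 z2"
    and "open W" "W \<subseteq> U" "(s1, s2) \<in> W" "F holomorphic2_on W"
  shows "Phi2 s1 s2 a z1 z2 = F (s1, s2)"
proof -
  have *: "Phi2_value s1 s2 a z1 z2 (F (s1, s2))"
    unfolding Phi2_value_def using assms by blast
  moreover have "(THE v. Phi2_value s1 s2 a z1 z2 v) = F (s1, s2)"
    using * by (rule the_equality) (rule Phi2_value_unique[OF _ *])
  ultimately show ?thesis
    unfolding Phi2_def by auto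
qed

end

theory Submission
  imports Defs
begin

text \<open>Series suffice for the whole proof.

  If \<open>z \<noteq> 1\<close>, a power series \<open>\<Sum>n. z\<^sup>n f n\<close> keeps its value under one summation by parts, and the new series
  (\<open>abel_sum\<close>) converges whenever \<open>f\<close> has bounded variation.  Done for the sum over \<open>n\<close> and then for
  the sum over \<open>m\<close>, this continues \<open>\<Phi>\<^sub>2\<close> holomorphically to a product of half-planes, with
  \<open>Re s\<^sub>i > 0\<close> if \<open>z\<^sub>i \<noteq> 1\<close> and \<open>Re s\<^sub>i > 1\<close> if \<open>z\<^sub>i = 1\<close> (\<open>Phi2_eq_double_sum\<close>).  This convex domain contains
  all the points at which nonvanishing is claimed if \<open>(z1, z2) \<noteq> (1, 1)\<close>.

  Nonvanishing there rests on \<open>abel_sum_convex_seq\<close>: the Abel sum of a decreasing convex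
  sequence lies in the same quarter plane as \<open>1 / (1 - z)\<close>, that is, it has a positive real part and
  its imaginary part has the sign of \<open>Im z\<close>.  As all differences of \<open>x powr (- \<sigma>)\<close> are nonnegative,
  the real and imaginary parts of the inner sums are again, up to sign, decreasing convex sequences
  in \<open>m\<close>.  So \<open>\<Phi>\<^sub>2 = X \<plusminus> i Y\<close> with \<open>X\<close> and \<open>Y\<close> in one quarter plane, \<open>Re X > 0\<close>, and \<open>Re Y > 0\<close> unless
  \<open>Y = 0\<close>; such numbers cannot cancel (\<open>double_sum_nonzero\<close>).

  If \<open>z1 = z2 = 1\<close>, comparing the inner sum with the integral \<open>(m + a) powr (1 - s2) / (s2 - 1)\<close> gives
  \<open>(s2 - 1) \<Phi>\<^sub>2 = \<zeta>(s1 + s2 - 1, a) - G\<close> with the Hurwitz zeta function \<open>\<zeta>\<close> and an error \<open>G\<close> that is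
  holomorphic for \<open>Re s1 > 0\<close>, \<open>Re s2 > 1\<close> (\<open>Phi2_eq_double_zeta\<close>).  At real points \<open>G\<close> is positive and
  \<open>O(s2 - 1)\<close> when \<open>s1 + s2\<close> is fixed.  Put \<open>u = s1 + s2 - 1\<close>, so \<open>0 < u < 1\<close>.  If \<open>a \<ge> 1/2\<close>, then the midpoint rule gives
  \<open>\<zeta>(u, a) \<le> 0\<close>, and \<open>\<Phi>\<^sub>2 < 0\<close> follows (\<open>double_zeta_nonzero\<close>).  If \<open>a < 1/2\<close>, then the trapezoidal rule
  gives \<open>\<zeta>(u, a) > 0\<close> at \<open>u = 1/2 - a\<close>, and \<open>\<Phi>\<^sub>2 > 0\<close> for \<open>s2\<close> close to \<open>1\<close>; at \<open>u = 1 - a\<close> one has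
  \<open>\<zeta>(u, a) \<le> 0\<close> and \<open>\<Phi>\<^sub>2 < 0\<close>.  There is a zero in between (\<open>double_zeta_has_zero\<close>).\<close>

section \<open>Holomorphic functions of two variables\<close>

lemma holomorphic2_on_I:
  assumes "\<And>p. p \<in> U \<Longrightarrow> (F has_derivative (\<lambda>(h, k). c p * h + d p * k)) (at p)"
  shows "F holomorphic2_on U"
  using assms unfolding holomorphic2_on_def by blast

lemma holomorphic2_on_const: "(\<lambda>_. c) holomorphic2_on U"
  by (rule holomorphic2_on_I[where c = "\<lambda>_. 0" and d = "\<lambda>_. 0"]) (simp add: case_prod_unfold)

lemma holomorphic2_on_fst: "fst holomorphic2_on U"
  by (rule holomorphic2_on_I[where c = "\<lambda>_. 1" and d = "\<lambda>_. 0"])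
     (auto intro!: derivative_eq_intros simp: case_prod_unfold)

lemma holomorphic2_on_snd: "snd holomorphic2_on U"
  by (rule holomorphic2_on_I[where c = "\<lambda>_. 0" and d = "\<lambda>_. 1"])
     (auto intro!: derivative_eq_intros simp: case_prod_unfold)

lemma holomorphic2_on_add:
  assumes "F holomorphic2_on U" "G holomorphic2_on U"
  shows "(\<lambda>p. F p + G p) holomorphic2_on U"
proof -
  have "(\<lambda>p. F p - (0 - G p)) holomorphic2_on U"
    by (intro holomorphic2_on_diff assms holomorphic2_on_const)
  then show ?thesis by simp
qed

lemma holomorphic2_on_compose:
  assumes F: "F holomorphic2_on U" and g: "g holomorphic_on V" "open V" "F ` U \<subseteq> V"
  shows "(\<lambda>p. g (F p)) holomorphic2_on U"
  unfolding holomorphic2_on_def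
proof
  fix p assume p: "p \<in> U"
  then obtain c d where 1: "(F has_derivative (\<lambda>(h, k). c * h + d * k)) (at p)"
    using F unfolding holomorphic2_on_def by meson
  have "(g has_derivative (*) (deriv g (F p))) (at (F p))"
    using holomorphic_derivI[OF g(1,2), of "F p"] g(3) p
    by (auto simp: has_field_derivative_def)
  from has_derivative_compose[OF 1 this]
  have "((\<lambda>p. g (F p)) has_derivative
          (\<lambda>(h, k). (deriv g (F p) * c) * h + (deriv g (F p) * d) * k)) (at p)"
    by (rule has_derivative_eq_rhs) (auto simp: fun_eq_iff algebra_simps)
  then show "\<exists>c d. ((\<lambda>p. g (F p)) has_derivative (\<lambda>(h, k). c * h + d * k)) (at p)"
    by blast
qed

text \<open>Osgood's lemma.  The partial derivative in the second variable is continuous because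
  Cauchy's inequality bounds the derivative of \<open>F (x, \<cdot>) - F (p, \<cdot>)\<close> by the values of this function, which
  are uniformly small for \<open>x\<close> near \<open>p\<close>.  One continuous partial derivative is
  enough for joint differentiability.\<close>

lemma holomorphic2_on_Osgood:
  assumes U: "open U" and cont: "continuous_on U F"
    and h1: "\<And>x y. (x, y) \<in> U \<Longrightarrow> (\<lambda>t. F (t, y)) holomorphic_on {t. (t, y) \<in> U}"
    and h2: "\<And>x y. (x, y) \<in> U \<Longrightarrow> (\<lambda>t. F (x, t)) holomorphic_on {t. (x, t) \<in> U}"
  shows "F holomorphic2_on U"
  unfolding holomorphic2_on_def
proof
  fix u assume u: "u \<in> U"
  obtain p q where pq: "u = (p, q)" by (cases u)
  obtain e where e: "e > 0" "ball u e \<subseteq> U"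
    using U u by (meson open_contains_ball)
  define r where "r = e / 4"
  have r: "r > 0" using e by (simp add: r_def)
  have box: "cball p (2 * r) \<times> cball q (2 * r) \<subseteq> U"
  proof
    fix v assume v: "v \<in> cball p (2 * r) \<times> cball q (2 * r)"
    then obtain x y where v': "v = (x, y)" "dist p x \<le> 2 * r" "dist q y \<le> 2 * r" by auto
    have "(dist p x)\<^sup>2 + (dist q y)\<^sup>2 \<le> (2 * r)\<^sup>2 + (2 * r)\<^sup>2"
      using v' by (intro add_mono power_mono) auto
    also have "\<dots> < e\<^sup>2"
      using e by (simp add: r_def power2_eq_square)
    finally have "dist u v < e"
      unfolding pq v' dist_prod_def using e by (simp add: real_less_lsqrt)
    then show "v \<in> U" using e by auto
  qed
  define X where "X = ball p r"
  define Y where "Y = ball q r"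
  define f where "f = (\<lambda>x y. F (x, y))"
  define D where "D = (\<lambda>x y. deriv (f x) y)"
  have hol2: "f x holomorphic_on ball q (2 * r)" if "x \<in> cball p (2 * r)" for x
  proof -
    have "(x, q) \<in> U" using box that r by auto
    from h2[OF this] show ?thesis
      unfolding f_def by (rule holomorphic_on_subset) (use box that in auto)
  qed
  have contf: "continuous_on (cball p (2 * r) \<times> cball q (2 * r)) F"
    using cont box continuous_on_subset by blast
  have unif: "uniformly_continuous_on (cball p (2 * r) \<times> cball q (2 * r)) F"
    by (intro compact_uniformly_continuous contf compact_Times) auto
  have fx: "((\<lambda>x. f x q) has_derivative (*) (deriv (\<lambda>x. f x q) p)) (at p within X)"
  proof -
    have "(\<lambda>x. f x q) holomorphic_on ball p (2 * r)"
      unfolding f_def using u box r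
      by (intro holomorphic_on_subset[OF h1[of p q]]) (auto simp: pq)
    then have "((\<lambda>x. f x q) has_field_derivative deriv (\<lambda>x. f x q) p) (at p)"
      using r by (auto intro: holomorphic_derivI)
    then show ?thesis
      using has_derivative_at_withinI has_field_derivative_def by blast
  qed
  have fy: "((\<lambda>y. f x y) has_derivative blinfun_apply (blinfun_mult_right (D x y))) (at y within Y)"
    if "x \<in> X" "y \<in> Y" for x y
  proof -
    have "(f x has_field_derivative D x y) (at y)"
      unfolding D_def using hol2[of x] that r by (intro holomorphic_derivI) (auto simp: X_def Y_def)
    then show ?thesis
      unfolding blinfun_mult_right.rep_eq
      using has_derivative_at_withinI has_field_derivative_def by blast
  qed
  \<comment> \<open>Cauchy's inequality on circles of radius \<open>r / 2\<close> around the points of \<open>Y\<close>\<close>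
  have near: "\<exists>d>0. \<forall>x\<in>ball p d \<inter> X. \<forall>y\<in>Y. dist (D x y) (D p y) \<le> \<epsilon>" if eps: "\<epsilon> > 0" for \<epsilon>
  proof -
    obtain d where d: "d > 0" "\<And>v w. v \<in> cball p (2 * r) \<times> cball q (2 * r) \<Longrightarrow>
        w \<in> cball p (2 * r) \<times> cball q (2 * r) \<Longrightarrow> dist w v < d \<Longrightarrow> dist (F w) (F v) < \<epsilon> * (r / 2)"
      using unif[unfolded uniformly_continuous_on_def, rule_format, of "\<epsilon> * (r / 2)"] r eps
      by (metis half_gt_zero mult_pos_pos)
    have "dist (D x y) (D p y) \<le> \<epsilon>" if x: "x \<in> ball p d \<inter> X" and y: "y \<in> Y" for x y
    proof -
      have sub: "cball y (r / 2) \<subseteq> ball q (2 * r)"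
        using y r unfolding Y_def
        by (intro cball_subset_ball_iff[THEN iffD2]) (auto simp: dist_commute)
      have xin: "x \<in> cball p (2 * r)" "p \<in> cball p (2 * r)" using x r by (auto simp: X_def)
      have hol: "f x holomorphic_on ball q (2 * r)" "f p holomorphic_on ball q (2 * r)"
        using hol2 xin by auto
      have "norm ((deriv ^^ 1) (\<lambda>y. f x y - f p y) y) \<le> fact 1 * (\<epsilon> * (r / 2)) / (r / 2) ^ 1"
      proof (rule Cauchy_inequality)
        show "(\<lambda>y. f x y - f p y) holomorphic_on ball y (r / 2)"
          using sub ball_subset_cball by (intro holomorphic_intros holomorphic_on_subset[OF hol(1)]
            holomorphic_on_subset[OF hol(2)]) blast+
        show "continuous_on (cball y (r / 2)) (\<lambda>y. f x y - f p y)"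
          using sub by (intro continuous_intros)
            (meson hol holomorphic_on_imp_continuous_on continuous_on_subset)+
        fix w assume "cmod (y - w) = r / 2"
        then have "w \<in> ball q (2 * r)" using sub by (auto simp: dist_norm)
        then have "dist (F (x, w)) (F (p, w)) < \<epsilon> * (r / 2)"
          using xin x by (intro d(2)) (auto simp: dist_Pair_Pair dist_commute)
        then show "cmod (f x w - f p w) \<le> \<epsilon> * (r / 2)"
          by (simp add: f_def dist_norm)
      qed (use r in auto)
      moreover have "deriv (\<lambda>y. f x y - f p y) y = D x y - D p y"
        unfolding D_def using hol y r
        by (intro deriv_diff) (auto simp: Y_def intro!: holomorphic_on_imp_differentiable_at)
      ultimately show ?thesis using r by (simp add: dist_norm)
    qed
    then show ?thesis using d(1) by blast
  qed
  have Dp: "continuous_on Y (D p)"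
  proof -
    have "deriv (f p) holomorphic_on ball q (2 * r)"
      using hol2[of p] r by (intro holomorphic_deriv) auto
    then have "D p holomorphic_on ball q (2 * r)"
      unfolding D_def .
    then show ?thesis
      by (rule continuous_on_subset[OF holomorphic_on_imp_continuous_on]) (use r in \<open>auto simp: Y_def\<close>)
  qed
  have contD: "continuous (at (p, q) within X \<times> Y) (\<lambda>(x, y). D x y)"
    unfolding continuous_within_eps_delta
  proof (intro allI impI)
    fix \<epsilon> :: real assume eps: "\<epsilon> > 0"
    obtain d where d: "d > 0" "\<forall>x\<in>ball p d \<inter> X. \<forall>y\<in>Y. dist (D x y) (D p y) \<le> \<epsilon> / 2"
      using near[of "\<epsilon> / 2"] eps by auto
    obtain d' where d': "d' > 0" "\<forall>y\<in>Y. dist y q < d' \<longrightarrow> dist (D p y) (D p q) < \<epsilon> / 2"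
      using Dp[unfolded continuous_on_iff, rule_format, of q "\<epsilon> / 2"] eps r by (auto simp: Y_def)
    have "dist (case v of (x, y) \<Rightarrow> D x y) (case (p, q) of (x, y) \<Rightarrow> D x y) < \<epsilon>"
      if v: "v \<in> X \<times> Y" "dist v (p, q) < min d d'" for v
    proof -
      obtain x y where xy: "v = (x, y)" by (cases v)
      have "dist x p < d" "dist y q < d'"
        using v dist_fst_le[of v "(p, q)"] dist_snd_le[of v "(p, q)"] by (auto simp: xy)
      then have "dist (D x y) (D p y) \<le> \<epsilon> / 2" "dist (D p y) (D p q) < \<epsilon> / 2"
        using v d(2)[rule_format, of x y] d'(2)[rule_format, of y] by (simp_all add: xy dist_commute)
      then show ?thesis
        using dist_triangle[of "D x y" "D p q" "D p y"] by (simp add: xy)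
    qed
    then show "\<exists>d>0. \<forall>v\<in>X \<times> Y. dist v (p, q) < d \<longrightarrow>
        dist (case v of (x, y) \<Rightarrow> D x y) (case (p, q) of (x, y) \<Rightarrow> D x y) < \<epsilon>"
      using d(1) d'(1) by (intro exI[of _ "min d d'"]) auto
  qed
  have contB: "continuous (at (p, q) within X \<times> Y) (\<lambda>(x, y). blinfun_mult_right (D x y))"
    using bounded_linear.continuous[OF bounded_linear_blinfun_mult_right contD]
    by (simp add: case_prod_unfold)
  have Y: "q \<in> Y" "convex Y" using r by (auto simp: Y_def)
  have at_eq: "at (p, q) within X \<times> Y = at (p, q)"
    using r by (intro at_within_open open_Times) (auto simp: X_def Y_def)
  have F_eq: "(\<lambda>(x, y). f x y) = F"
    by (auto simp: f_def)
  have "(F has_derivative (\<lambda>(tx, ty). deriv (\<lambda>x. f x q) p * tx + D p q * ty)) (at (p, q))"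
    using has_derivative_partialsI[OF fx fy contB Y]
    unfolding at_eq F_eq blinfun_mult_right.rep_eq .
  then show "\<exists>c d. (F has_derivative (\<lambda>(h, k). c * h + d * k)) (at u)"
    unfolding pq by blast
qed

text \<open>The bound starts at the index \<open>1\<close>, because the majorants in use are powers
  \<open>real n powr (- c)\<close>, which have the value \<open>0\<close> at \<open>n = 0\<close>.\<close>

definition locally_dominated ::
    "(nat \<Rightarrow> complex \<times> complex \<Rightarrow> complex) \<Rightarrow> (complex \<times> complex) set \<Rightarrow> bool" where
  "locally_dominated f U \<longleftrightarrow>
     (\<forall>p\<in>U. \<exists>r>0. \<exists>M. summable M \<and> (\<forall>q\<in>U \<inter> ball p r. \<forall>n\<ge>1. norm (f n q) \<le> M n))"

text \<open>Uniform convergence makes the sum continuous, and on each line parallel to a coordinate axis it is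
  the classical theorem on uniform limits in one variable.  Osgood's lemma combines the two.\<close>

lemma holomorphic2_on_suminf:
  assumes U: "open U" and f: "\<And>n. f n holomorphic2_on U" and dom: "locally_dominated f U"
  shows "(\<lambda>p. \<Sum>n. f n p) holomorphic2_on U"
proof (rule holomorphic2_on_Osgood[OF U])
  define S where "S = (\<lambda>N p. \<Sum>n<N. f n p)"
  have S: "S N holomorphic2_on U" for N
    unfolding S_def by (induction N) (auto intro!: holomorphic2_on_const holomorphic2_on_add f)
  have unif: "\<exists>r>0. ball p r \<subseteq> U \<and> uniform_limit (ball p r) S (\<lambda>p. \<Sum>n. f n p) sequentially"
    if p: "p \<in> U" for p
  proof -
    obtain r M where r: "r > 0" "summable M" "\<forall>q\<in>U \<inter> ball p r. \<forall>n\<ge>1. norm (f n q) \<le> M n"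
      using dom p unfolding locally_dominated_def by blast
    obtain e where e: "e > 0" "ball p e \<subseteq> U"
      using U p by (meson open_contains_ball)
    have "uniform_limit (ball p (min r e)) S (\<lambda>p. \<Sum>n. f n p) sequentially"
      unfolding S_def using r e
      by (intro Weierstrass_m_test_ev eventually_sequentiallyI[of 1]) auto
    moreover have "ball p (min r e) \<subseteq> U" "min r e > 0" using e r by auto
    ultimately show ?thesis by blast
  qed
  show "continuous_on U (\<lambda>p. \<Sum>n. f n p)"
  proof (rule continuous_at_imp_continuous_on, rule ballI)
    fix p assume p: "p \<in> U"
    obtain r where r: "r > 0" "ball p r \<subseteq> U" "uniform_limit (ball p r) S (\<lambda>p. \<Sum>n. f n p) sequentially"
      using unif[OF p] by blast
    have "continuous_on (ball p r) (\<lambda>p. \<Sum>n. f n p)"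
      using r(2) by (intro uniform_limit_theorem[OF always_eventually r(3)])
        (auto intro: continuous_on_subset[OF holomorphic2_on_imp_continuous_on[OF S]])
    then show "isCont (\<lambda>p. \<Sum>n. f n p) p"
      using r(1) by (simp add: continuous_on_eq_continuous_at)
  qed
  have line: "(\<lambda>t. \<Sum>n. f n (l t)) holomorphic_on {t. l t \<in> U}"
    if lin: "\<And>A. continuous_on A l" and iso: "\<And>s t. dist (l s) (l t) = dist s t"
      and hol: "\<And>F. F holomorphic2_on U \<Longrightarrow> (\<lambda>t. F (l t)) holomorphic_on {t. l t \<in> U}"
    for l :: "complex \<Rightarrow> complex \<times> complex"
  proof (rule holomorphic_uniform_sequence[where f = "\<lambda>N t. S N (l t)"])
    show "open {t. l t \<in> U}"
      using open_vimage[OF U lin] by (simp add: vimage_def)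
    show "(\<lambda>t. S N (l t)) holomorphic_on {t. l t \<in> U}" for N
      by (rule hol[OF S])
    fix t assume t: "t \<in> {t. l t \<in> U}"
    then obtain r where r: "r > 0" "ball (l t) r \<subseteq> U"
        "uniform_limit (ball (l t) r) S (\<lambda>p. \<Sum>n. f n p) sequentially"
      using unif[of "l t"] by blast
    have sub: "l ` cball t (r / 2) \<subseteq> ball (l t) r"
      using r(1) by (auto simp: iso)
    have "uniform_limit (cball t (r / 2)) (\<lambda>N t. S N (l t)) (\<lambda>t. \<Sum>n. f n (l t)) sequentially"
      by (rule uniform_limit_compose'[OF r(3)]) (use sub in auto)
    then show "\<exists>d>0. cball t d \<subseteq> {t. l t \<in> U} \<and>
        uniform_limit (cball t d) (\<lambda>N t. S N (l t)) (\<lambda>t. \<Sum>n. f n (l t)) sequentially"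
      using r sub by (intro exI[of _ "r / 2"]) auto
  qed
  show "(\<lambda>t. \<Sum>n. f n (t, y)) holomorphic_on {t. (t, y) \<in> U}" for y
    using holomorphic2_on_line[of _ U 0 1 y 0]
    by (intro line) (auto intro!: continuous_intros simp: dist_Pair_Pair)
  show "(\<lambda>t. \<Sum>n. f n (x, t)) holomorphic_on {t. (x, t) \<in> U}" for x
    using holomorphic2_on_line[of _ U x 0 0 1]
    by (intro line) (auto intro!: continuous_intros simp: dist_Pair_Pair)
qed

lemma holomorphic2_imp_meromorphic2_on:
  assumes "open U" "F holomorphic2_on U"
  shows "F meromorphic2_on U"
  unfolding meromorphic2_on_def
proof
  fix p assume "p \<in> U"
  moreover have "U \<subseteq> closure {q \<in> U. (1::complex) \<noteq> 0}"
    using closure_subset by auto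
  ultimately show "\<exists>V g h. open V \<and> p \<in> V \<and> g holomorphic2_on V \<and> h holomorphic2_on V \<and>
      V \<subseteq> closure {q \<in> V. h q \<noteq> 0} \<and> (\<forall>q\<in>V. h q \<noteq> 0 \<longrightarrow> F q = g q / h q)"
    using assms holomorphic2_on_const[of 1 U]
    by (intro exI[of _ U] exI[of _ F] exI[of _ "\<lambda>_. 1"]) simp
qed

section \<open>Abel sums with decreasing convex coefficients\<close>

text \<open>For \<open>z \<noteq> 1\<close> this is the result of one summation by parts.  It makes sense for \<open>|z| \<le> 1\<close> as soon as
  \<open>f\<close> has bounded variation, also when the power series of \<open>f\<close> diverges at \<open>z\<close>.\<close>

definition abel_sum :: "complex \<Rightarrow> (nat \<Rightarrow> complex) \<Rightarrow> complex" where
  "abel_sum z f =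
     (if z = 1 then \<Sum>n. f n else (f 0 - z * (\<Sum>n. z ^ n * (f n - f (Suc n)))) / (1 - z))"

definition abel_summable :: "complex \<Rightarrow> (nat \<Rightarrow> complex) \<Rightarrow> bool" where
  "abel_summable z f \<longleftrightarrow>
     (if z = 1 then summable (\<lambda>n. norm (f n)) else summable (\<lambda>n. norm (f n - f (Suc n))))"

lemma summable_power_mult:
  fixes z :: "'a::{real_normed_field, banach}"
  assumes "norm z \<le> 1" "summable (\<lambda>n. norm (f n))"
  shows "summable (\<lambda>n. z ^ n * f n)"
proof (rule summable_comparison_test'[OF assms(2), of 0])
  fix n
  have "norm z ^ n \<le> 1" using assms(1) by (simp add: power_le_one)
  then show "norm (z ^ n * f n) \<le> norm (f n)"
    by (simp add: norm_mult norm_power mult_left_le_one_le)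
qed

lemma abel_sum_eq_suminf:
  assumes "z \<noteq> 0" and sm: "summable (\<lambda>n. z ^ n * f n)"
  shows "abel_sum z f = (\<Sum>n. z ^ n * f n)"
proof (cases "z = 1")
  case True
  then show ?thesis by (simp add: abel_sum_def)
next
  case False
  define G where "G = (\<Sum>n. z ^ n * f n)"
  have G: "(\<lambda>n. z ^ n * f n) sums G"
    unfolding G_def using sm by (rule summable_sums)
  have "(\<lambda>n. z ^ Suc n * f (Suc n)) sums (G - f 0)"
    using sums_split_initial_segment[OF G, of 1] by simp
  from sums_diff[OF sums_mult[OF G, of z] this]
  have "(\<lambda>n. z * (z ^ n * (f n - f (Suc n)))) sums (z * G - (G - f 0))"
    by (simp add: algebra_simps)
  from sums_divide[OF this, of z]
  have "(\<lambda>n. z ^ n * (f n - f (Suc n))) sums ((z * G - (G - f 0)) / z)"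
    using assms(1) by simp
  then have "z * (\<Sum>n. z ^ n * (f n - f (Suc n))) = z * G - (G - f 0)"
    using assms(1) by (simp add: sums_iff)
  then show ?thesis
    unfolding G_def[symmetric] abel_sum_def using False by (simp add: divide_eq_eq) (simp add: algebra_simps)
qed

lemma abel_sum_cong: "(\<And>n. f n = g n) \<Longrightarrow> abel_sum z f = abel_sum z g"
  by presburger

lemma abel_sum_add:
  assumes z: "norm z \<le> 1" and f: "abel_summable z f" and g: "abel_summable z g"
  shows "abel_sum z (\<lambda>n. f n + g n) = abel_sum z f + abel_sum z g"
proof (cases "z = 1")
  case True
  then show ?thesis
    using f g by (simp add: abel_sum_def abel_summable_def suminf_add summable_norm_cancel)
next
  case False
  have "summable (\<lambda>n. z ^ n * (f n - f (Suc n)))" "summable (\<lambda>n. z ^ n * (g n - g (Suc n)))"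
    using f g False by (auto simp: abel_summable_def intro!: summable_power_mult[OF z])
  from suminf_add[OF this]
  have *: "(\<Sum>n. z ^ n * (f n + g n - (f (Suc n) + g (Suc n)))) =
      (\<Sum>n. z ^ n * (f n - f (Suc n))) + (\<Sum>n. z ^ n * (g n - g (Suc n)))"
    by (simp add: algebra_simps)
  have "(f 0 + g 0 - z * (A + B)) / (1 - z) = (f 0 - z * A) / (1 - z) + (g 0 - z * B) / (1 - z)"
    for A B
    unfolding add_divide_distrib[symmetric] by (simp add: algebra_simps)
  then show ?thesis
    using False unfolding abel_sum_def * by simp
qed

lemma abel_sum_cmult:
  assumes z: "norm z \<le> 1" and f: "abel_summable z f"
  shows "abel_sum z (\<lambda>n. c * f n) = c * abel_sum z f"
proof (cases "z = 1")
  case True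
  then show ?thesis
    using f by (simp add: abel_sum_def abel_summable_def suminf_mult summable_norm_cancel)
next
  case False
  have "summable (\<lambda>n. z ^ n * (f n - f (Suc n)))"
    using f False by (auto simp: abel_summable_def intro!: summable_power_mult[OF z])
  from suminf_mult[OF this, of c]
  have *: "(\<Sum>n. z ^ n * (c * f n - c * f (Suc n))) = c * (\<Sum>n. z ^ n * (f n - f (Suc n)))"
    by (simp add: algebra_simps)
  have "(c * f 0 - z * (c * A)) / (1 - z) = c * ((f 0 - z * A) / (1 - z))" for A
    by (simp add: algebra_simps)
  then show ?thesis
    using False unfolding abel_sum_def * by simp
qed

lemma abel_summable_cmult: "abel_summable z f \<Longrightarrow> abel_summable z (\<lambda>n. c * f n)"
  unfolding abel_summable_def
  by (auto simp: right_diff_distrib[symmetric] norm_mult intro: summable_mult)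

lemma abel_sum_diff:
  assumes "norm z \<le> 1" "abel_summable z f" "abel_summable z g"
  shows "abel_sum z (\<lambda>n. f n - g n) = abel_sum z f - abel_sum z g"
  using abel_sum_add[OF assms(1,2) abel_summable_cmult[OF assms(3), of "-1"]]
    abel_sum_cmult[OF assms(1,3), of "-1"] by simp

text \<open>For decreasing \<open>f \<ge> 0\<close> this bound is at most \<open>2 f 0 / |1 - z|\<close>, whereas an estimate of the power series term by
  term would involve the sum of \<open>f\<close>, which may be infinite.\<close>

lemma norm_abel_sum_le:
  assumes z: "norm z \<le> 1" "z \<noteq> 1" and f: "abel_summable z f"
  shows "norm (abel_sum z f) \<le> (norm (f 0) + (\<Sum>n. norm (f n - f (Suc n)))) / norm (1 - z)"
proof -
  have s: "summable (\<lambda>n. norm (f n - f (Suc n)))"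
    using f z by (simp add: abel_summable_def)
  have le: "norm (z ^ n * (f n - f (Suc n))) \<le> norm (f n - f (Suc n))" for n
    using z(1) by (simp add: norm_mult norm_power mult_left_le_one_le power_le_one)
  have s': "summable (\<lambda>n. norm (z ^ n * (f n - f (Suc n))))"
    by (rule summable_comparison_test'[OF s, of 0]) (use le in simp)
  have "norm (\<Sum>n. z ^ n * (f n - f (Suc n))) \<le> (\<Sum>n. norm (f n - f (Suc n)))"
    by (rule order.trans[OF summable_norm[OF s'] suminf_le[OF le s' s]])
  then have "norm (z * (\<Sum>n. z ^ n * (f n - f (Suc n)))) \<le> 1 * (\<Sum>n. norm (f n - f (Suc n)))"
    unfolding norm_mult using z(1) by (intro mult_mono) auto
  then have "norm (f 0 - z * (\<Sum>n. z ^ n * (f n - f (Suc n)))) \<le>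
      norm (f 0) + (\<Sum>n. norm (f n - f (Suc n)))"
    using norm_triangle_ineq4[of "f 0" "z * (\<Sum>n. z ^ n * (f n - f (Suc n)))"] by simp
  then show ?thesis
    using z(2) by (simp add: abel_sum_def norm_divide divide_right_mono)
qed

text \<open>The coefficients that occur are \<open>n \<mapsto> (n + x) powr (- \<sigma>)\<close> and its differences.  The
  three conditions below are the part of their complete monotonicity that two summations by parts
  can use.\<close>

definition convex_seq :: "(nat \<Rightarrow> real) \<Rightarrow> bool" where
  "convex_seq f \<longleftrightarrow> (\<forall>n. 0 \<le> f n \<and> f (Suc n) \<le> f n \<and> 2 * f (Suc n) \<le> f n + f (Suc (Suc n)))"

lemma convex_seqD:
  assumes "convex_seq f"
  shows "0 \<le> f n" "f (Suc n) \<le> f n" "2 * f (Suc n) \<le> f n + f (Suc (Suc n))"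
  using assms by (auto simp: convex_seq_def)

lemma convex_seq_le_0: "convex_seq f \<Longrightarrow> f n \<le> f 0"
  by (rule decseqD[of f 0 n]) (auto simp: decseq_Suc_iff dest: convex_seqD)

lemma convex_seq_mult:
  assumes f: "convex_seq f" and g: "convex_seq g"
  shows "convex_seq (\<lambda>n. f n * g n)"
  unfolding convex_seq_def
proof (intro allI conjI)
  fix n
  note F = convex_seqD[OF f, of n] convex_seqD[OF f, of "Suc n"] convex_seqD(1)[OF f, of "Suc (Suc n)"]
  note G = convex_seqD[OF g, of n] convex_seqD[OF g, of "Suc n"] convex_seqD(1)[OF g, of "Suc (Suc n)"]
  show "0 \<le> f n * g n" using F G by simp
  show "f (Suc n) * g (Suc n) \<le> f n * g n" using F G by (intro mult_mono) auto
  have "f n * g n + f (Suc (Suc n)) * g (Suc (Suc n)) - 2 * (f (Suc n) * g (Suc n)) =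
      f n * (g n + g (Suc (Suc n)) - 2 * g (Suc n)) +
      2 * ((f n - f (Suc n)) * (g (Suc n) - g (Suc (Suc n)))) +
      (f n + f (Suc (Suc n)) - 2 * f (Suc n)) * g (Suc (Suc n))"
    by algebra
  also have "\<dots> \<ge> 0"
    by (intro add_nonneg_nonneg mult_nonneg_nonneg) (use F G in linarith)+
  finally show "2 * (f (Suc n) * g (Suc n)) \<le> f n * g n + f (Suc (Suc n)) * g (Suc (Suc n))"
    by simp
qed

lemma convex_seq_power:
  assumes "0 \<le> r" "r \<le> (1::real)"
  shows "convex_seq (\<lambda>n. r ^ n)"
  unfolding convex_seq_def
proof (intro allI conjI)
  fix n
  show "0 \<le> r ^ n" "r ^ Suc n \<le> r ^ n"
    using assms by (auto simp: mult_left_le_one_le)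
  have "0 \<le> r ^ n * (1 - r)\<^sup>2" using assms by simp
  then show "2 * r ^ Suc n \<le> r ^ n + r ^ Suc (Suc n)"
    by (simp add: power2_eq_square algebra_simps)
qed

lemma convex_seq_summable_diff:
  assumes "convex_seq f"
  shows "summable (\<lambda>n. f n - f (Suc n))"
proof -
  have "decseq f" "\<And>n. 0 \<le> f n"
    using assms by (auto simp: decseq_Suc_iff dest: convex_seqD)
  then obtain L where "f \<longlonglongrightarrow> L"
    using decseq_convergent[of f 0] by metis
  then show ?thesis by (rule telescope_summable')
qed

lemma convex_seq_abel_summable:
  assumes "convex_seq f" "z = 1 \<Longrightarrow> summable f"
  shows "abel_summable z (\<lambda>n. of_real (f n))"
  using assms convex_seqD[OF assms(1)] convex_seq_summable_diff[OF assms(1)]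
  by (auto simp: abel_summable_def simp flip: of_real_diff)

lemma abs_Im_power_le:
  assumes "norm (w::complex) \<le> 1"
  shows "\<bar>Im (w ^ n)\<bar> \<le> real n * \<bar>Im w\<bar>"
proof (induction n)
  case (Suc n)
  have "\<bar>Re w\<bar> \<le> 1" "\<bar>Re (w ^ n)\<bar> \<le> 1"
    using assms abs_Re_le_cmod[of w] abs_Re_le_cmod[of "w ^ n"] power_le_one[of "norm w" n]
    by (auto simp: norm_power)
  then have "\<bar>Re w * Im (w ^ n)\<bar> \<le> 1 * (real n * \<bar>Im w\<bar>)" "\<bar>Im w * Re (w ^ n)\<bar> \<le> \<bar>Im w\<bar> * 1"
    unfolding abs_mult using Suc by (intro mult_mono; simp)+
  then show ?case by (simp add: algebra_simps)
qed simp

text \<open>Summing by parts twice gives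
  \<open>|1 - w|\<^sup>2 S = f 0 (1 - cnj w) + (\<Sum>n. e n (1 - w\<^sup>n\<^sup>+\<^sup>1))\<close> with the second differences \<open>e n \<ge> 0\<close>,
  because \<open>w / (1 - w)\<^sup>2 = - 1 / |1 - w|\<^sup>2\<close> on the unit circle.  The real part of the last sum is
  visibly nonnegative, and its imaginary part is at most \<open>|Im w| (\<Sum>n. (n + 1) e n) \<le> |Im w| f 0\<close>.\<close>

lemma abel_sum_circle:
  assumes f: "convex_seq f" and w: "norm w = 1" "w \<noteq> 1"
  defines "S \<equiv> abel_sum w (\<lambda>n. of_real (f n))"
  shows "f 0 / 2 \<le> Re S" "0 \<le> Im w \<Longrightarrow> 0 \<le> Im S" "Im w \<le> 0 \<Longrightarrow> Im S \<le> 0"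
proof -
  define d where "d n = f n - f (Suc n)" for n
  define e where "e n = d n - d (Suc n)" for n
  have e0: "0 \<le> e n" for n
    using convex_seqD(3)[OF f, of n] by (simp add: e_def d_def)
  have d0: "0 \<le> d n" for n
    using convex_seqD(2)[OF f, of n] by (simp add: d_def)
  have d: "summable d"
    unfolding d_def using convex_seq_summable_diff[OF f] .
  have e: "e sums d 0"
    using telescope_sums'[OF summable_LIMSEQ_zero[OF d]] by (simp add: e_def[abs_def])
  define E where "E = (\<Sum>n. w ^ n * of_real (e n))"
  define P where "P = of_real (d 0) - w * E"
  have sE: "(\<lambda>n. w ^ n * of_real (e n)) sums E"
    unfolding E_def using e e0 w
    by (intro summable_sums summable_power_mult) (auto simp: sums_iff)
  have sP: "(\<lambda>n. of_real (e n) * (1 - w ^ Suc n)) sums P"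
    using sums_diff[OF sums_of_real[OF e] sums_mult[OF sE, of w]]
    by (simp add: P_def algebra_simps)
  have "abel_sum w (\<lambda>n. of_real (d n)) = (\<Sum>n. w ^ n * of_real (d n))"
    using w d d0 by (intro abel_sum_eq_suminf summable_power_mult) auto
  moreover have "abel_sum w (\<lambda>n. of_real (d n)) = P / (1 - w)"
    using w by (simp add: abel_sum_def P_def E_def e_def)
  moreover have "S = (of_real (f 0) - w * (\<Sum>n. w ^ n * of_real (d n))) / (1 - w)"
    using w by (simp add: S_def abel_sum_def d_def)
  ultimately have S: "S = (of_real (f 0) - w * (P / (1 - w))) / (1 - w)"
    by simp
  define N where "N = (cmod (1 - w))\<^sup>2"
  have N0: "N > 0" using w by (simp add: N_def)
  have ww: "w * cnj w = 1"
    using w by (simp add: complex_norm_square[symmetric])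
  have N: "of_real N = (1 - w) * (1 - cnj w)"
    unfolding N_def complex_norm_square by simp
  have wc: "w * (1 - cnj w) = - (1 - w)"
    using ww by (simp add: algebra_simps)
  have cancel: "(1 - w) * (P / (1 - w)) = P"
    using w by simp
  have expand: "(1 - cnj w) * (A - w * Q) = A * (1 - cnj w) - (w * (1 - cnj w)) * Q" for A Q
    by (simp add: algebra_simps)
  have "of_real N * S = (1 - cnj w) * (of_real (f 0) - w * (P / (1 - w)))"
    using w unfolding S N by simp
  also have "\<dots> = of_real (f 0) * (1 - cnj w) + P"
    unfolding expand wc mult_minus_left cancel by simp
  finally have "of_real N * S = of_real (f 0) * (1 - cnj w) + P" .
  then have RI: "N * Re S = f 0 * (1 - Re w) + Re P" "N * Im S = f 0 * Im w + Im P"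
    by (auto simp: complex_eq_iff)
  have N': "N = 2 * (1 - Re w)"
  proof -
    have "(Re w)\<^sup>2 + (Im w)\<^sup>2 = 1" using w(1) by (simp add: cmod_def)
    then show ?thesis unfolding N_def cmod_power2 by (simp add: power2_eq_square algebra_simps)
  qed
  have "0 \<le> Re P"
  proof (rule sums_le[OF _ sums_zero sums_Re[OF sP]])
    fix n
    have "Re (w ^ Suc n) \<le> 1"
      using complex_Re_le_cmod[of "w ^ Suc n"] w by (simp add: norm_power del: power_Suc)
    then show "0 \<le> Re (of_real (e n) * (1 - w ^ Suc n))"
      using e0[of n] by (simp del: power_Suc)
  qed
  then have "N * (f 0 / 2) \<le> N * Re S"
    unfolding RI by (simp add: N' algebra_simps)
  then show "f 0 / 2 \<le> Re S" using N0 by simp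
  \<comment> \<open>\<open>(\<Sum>n. (n + 1) e n) \<le> f 0\<close>, read off from the partial sums\<close>
  have part: "(\<Sum>n<k. real (Suc n) * e n) = f 0 - f k - real k * d k" for k
    by (induction k) (auto simp: e_def d_def algebra_simps)
  have term_le: "\<bar>Im (of_real (e n) * (1 - w ^ Suc n))\<bar> \<le> \<bar>Im w\<bar> * (real (Suc n) * e n)" for n
    using mult_left_mono[OF abs_Im_power_le[of w "Suc n"] e0[of n]] w e0[of n]
    by (simp add: abs_mult mult_ac del: power_Suc of_nat_Suc)
  have part_le: "\<bar>\<Sum>n<k. Im (of_real (e n) * (1 - w ^ Suc n))\<bar> \<le> \<bar>Im w\<bar> * f 0" for k
  proof -
    have "\<bar>\<Sum>n<k. Im (of_real (e n) * (1 - w ^ Suc n))\<bar> \<le> (\<Sum>n<k. \<bar>Im w\<bar> * (real (Suc n) * e n))"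
      by (rule order.trans[OF sum_abs sum_mono]) (rule term_le)
    also have "\<dots> = \<bar>Im w\<bar> * (f 0 - f k - real k * d k)"
      by (simp only: part sum_distrib_left[symmetric])
    also have "\<dots> \<le> \<bar>Im w\<bar> * f 0"
      using convex_seqD(1)[OF f, of k] mult_nonneg_nonneg[OF of_nat_0_le_iff[of k] d0[of k]]
      by (intro mult_left_mono) simp_all
    finally show ?thesis .
  qed
  have "\<bar>Im P\<bar> \<le> \<bar>Im w\<bar> * f 0"
    by (rule LIMSEQ_le_const2[OF tendsto_rabs[OF sums_Im[OF sP, unfolded sums_def]]])
       (use part_le in auto)
  then have "0 \<le> Im w \<Longrightarrow> 0 \<le> N * Im S" "Im w \<le> 0 \<Longrightarrow> N * Im S \<le> 0"
    unfolding RI using convex_seqD(1)[OF f, of 0] by (auto simp: abs_if mult_ac split: if_splits)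
  then show "0 \<le> Im w \<Longrightarrow> 0 \<le> Im S" "Im w \<le> 0 \<Longrightarrow> Im S \<le> 0"
    using N0 by (auto simp: zero_le_mult_iff mult_le_0_iff)
qed

text \<open>The sum inherits the position of \<open>1 / (1 - z)\<close>.  A factor \<open>r = |z| < 1\<close> is absorbed
  into the coefficients: \<open>f n * r ^ n\<close> is again decreasing and convex.\<close>

lemma abel_sum_convex_seq:
  assumes f: "convex_seq f" "z = 1 \<Longrightarrow> summable f" and z: "z \<noteq> 0" "norm z \<le> 1"
  defines "S \<equiv> abel_sum z (\<lambda>n. of_real (f n))"
  shows "f 0 / 2 \<le> Re S" "0 \<le> Im z \<Longrightarrow> 0 \<le> Im S" "Im z \<le> 0 \<Longrightarrow> Im S \<le> 0"
proof -
  define r w where "r = norm z" and "w = z / of_real r"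
  have r: "0 < r" "r \<le> 1" using z by (auto simp: r_def)
  have w: "norm w = 1" "z = of_real r * w" using r by (auto simp: w_def norm_divide r_def)
  define g where "g n = f n * r ^ n" for n
  have g: "convex_seq g"
    unfolding g_def using r by (intro convex_seq_mult f(1) convex_seq_power) auto
  have S: "S = abel_sum w (\<lambda>n. of_real (g n))" and sm: "w = 1 \<Longrightarrow> summable g"
  proof -
    consider "r = 1" | "r < 1" using r by linarith
    then have "S = abel_sum w (\<lambda>n. of_real (g n)) \<and> (w = 1 \<longrightarrow> summable g)"
    proof cases
      case 1
      then show ?thesis using f(2) by (simp add: S_def w_def g_def[abs_def])
    next
      case 2
      have sg: "summable g"
      proof (rule summable_comparison_test'[of "\<lambda>n. f 0 * r ^ n" 0])
        show "summable (\<lambda>n. f 0 * r ^ n)"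
          using 2 r by (intro summable_mult summable_geometric) auto
        show "norm (g n) \<le> f 0 * r ^ n" for n
          using convex_seq_le_0[OF f(1), of n] convex_seqD(1)[OF f(1), of n] r
          by (simp add: g_def abs_mult mult_right_mono)
      qed
      have eq: "z ^ n * of_real (f n) = w ^ n * of_real (g n)" for n
        by (simp add: w(2) g_def power_mult_distrib mult_ac)
      have s2: "summable (\<lambda>n. w ^ n * of_real (g n))"
        using sg convex_seqD(1)[OF g] w by (intro summable_power_mult) auto
      then have s1: "summable (\<lambda>n. z ^ n * of_real (f n))"
        by (simp add: eq)
      have "w \<noteq> 0" using w by auto
      then show ?thesis
        using abel_sum_eq_suminf[OF _ s2] abel_sum_eq_suminf[OF z(1) s1] sg
        by (simp add: eq S_def)
    qed
    then show "S = abel_sum w (\<lambda>n. of_real (g n))" "w = 1 \<Longrightarrow> summable g" by auto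
  qed
  have g0: "g 0 = f 0" by (simp add: g_def)
  have Im: "0 \<le> Im z \<longleftrightarrow> 0 \<le> Im w" "Im z \<le> 0 \<longleftrightarrow> Im w \<le> 0"
    using r by (auto simp: w(2) zero_le_mult_iff mult_le_0_iff)
  have "f 0 / 2 \<le> Re S \<and> (0 \<le> Im z \<longrightarrow> 0 \<le> Im S) \<and> (Im z \<le> 0 \<longrightarrow> Im S \<le> 0)"
  proof (cases "w = 1")
    case True
    have "(\<Sum>n<1. g n) \<le> (\<Sum>n. g n)"
      using sm True convex_seqD(1)[OF g] by (intro sum_le_suminf) auto
    moreover have "0 \<le> g 0" using convex_seqD(1)[OF g] .
    moreover have "S = of_real (\<Sum>n. g n)"
      using sm True by (simp add: S abel_sum_def suminf_of_real)
    ultimately show ?thesis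
      using g0 by simp
  next
    case False
    then show ?thesis
      unfolding S Im using abel_sum_circle[OF g w(1) False] g0 by simp
  qed
  then show "f 0 / 2 \<le> Re S" "0 \<le> Im z \<Longrightarrow> 0 \<le> Im S" "Im z \<le> 0 \<Longrightarrow> Im S \<le> 0"
    by auto
qed

section \<open>Powers with complex exponent\<close>

definition pw :: "complex \<Rightarrow> real \<Rightarrow> complex" where
  "pw s x = of_real x powr (- s)"

lemma norm_pw: "0 < x \<Longrightarrow> norm (pw s x) = x powr (- Re s)"
  by (simp add: pw_def norm_powr_real_powr)

lemma pw_of_real: "0 < x \<Longrightarrow> pw (of_real \<sigma>) x = of_real (x powr (- \<sigma>))"
  unfolding pw_def of_real_minus[symmetric] by (subst powr_of_real) auto

lemma pw_add: "pw (s + t) x = pw s x * pw t x"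
  by (simp add: pw_def powr_add[symmetric])

lemma divide_powr_eq_pw: "c / of_real x powr s = c * pw s x"
  by (simp add: pw_def powr_minus divide_inverse)

lemma pw_holomorphic: "0 < x \<Longrightarrow> (\<lambda>s. pw s x) holomorphic_on A"
  unfolding pw_def powr_def by (auto intro!: holomorphic_intros)

lemma holomorphic2_on_pw:
  assumes "0 < x" "f holomorphic2_on U"
  shows "(\<lambda>p. pw (f p) x) holomorphic2_on U"
  by (rule holomorphic2_on_compose[OF assms(2) pw_holomorphic[OF assms(1), of UNIV]]) auto

lemma has_vector_derivative_pw:
  assumes "0 < x"
  shows "(pw s has_vector_derivative (- s * pw (s + 1) x)) (at x within A)"
proof -
  have "((\<lambda>z. z powr (- s)) has_field_derivative (- s * of_real x powr (- s - 1))) (at (of_real x))"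
    using assms by (intro has_field_derivative_powr) auto
  from has_vector_derivative_real_field[OF this] show ?thesis
    by (simp add: pw_def[abs_def])
qed

lemma norm_diff_le_vector_derivative:
  fixes f :: "real \<Rightarrow> 'a::real_normed_vector"
  assumes xy: "x \<le> y"
    and f: "\<And>t. x \<le> t \<Longrightarrow> t \<le> y \<Longrightarrow> (f has_vector_derivative f' t) (at t within {x..y})"
    and B: "\<And>t. x \<le> t \<Longrightarrow> t \<le> y \<Longrightarrow> norm (f' t) \<le> B"
  shows "norm (f x - f y) \<le> B * (y - x)"
proof -
  have B0: "0 \<le> B" using B[of x] xy norm_ge_zero[of "f' x"] by linarith
  have "norm (f x - f y) \<le> B * norm (x - y)"
  proof (rule differentiable_bound[of "{x..y}" f "\<lambda>t h. h *\<^sub>R f' t"])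
    show "(f has_derivative (\<lambda>h. h *\<^sub>R f' t)) (at t within {x..y})" if "t \<in> {x..y}" for t
      using f[of t] that by (simp add: has_vector_derivative_def)
    show "onorm (\<lambda>h. h *\<^sub>R f' t) \<le> B" if "t \<in> {x..y}" for t
      by (rule onorm_bound) (use B0 B[of t] that in \<open>auto simp: mult.commute[of B] mult_left_mono\<close>)
  qed (use xy in auto)
  then show ?thesis using xy by simp
qed

lemma norm_pw_diff:
  assumes x: "0 < x" "x \<le> y" and s: "-1 \<le> Re s"
  shows "norm (pw s x - pw s y) \<le> norm s * x powr (- Re s - 1) * (y - x)"
proof (rule norm_diff_le_vector_derivative[OF x(2)])
  fix t assume t: "x \<le> t" "t \<le> y"
  show "(pw s has_vector_derivative (- s * pw (s + 1) t)) (at t within {x..y})"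
    using x t by (intro has_vector_derivative_pw) auto
  have "t powr (- Re s - 1) \<le> x powr (- Re s - 1)"
    using x t s by (intro powr_mono2') auto
  then show "norm (- s * pw (s + 1) t) \<le> norm s * x powr (- Re s - 1)"
    using x t by (simp add: norm_mult norm_pw mult_left_mono)
qed

text \<open>Each difference gains one power of \<open>x\<close>.  This is what makes the Abel sum over \<open>n\<close>, seen as a
  sequence in \<open>m\<close>, a sequence of bounded variation.\<close>

lemma norm_pw_diff2:
  assumes x: "0 < x" and s: "-1 \<le> Re s"
  shows "norm ((pw s x - pw s (x + 1)) - (pw s (x + 1) - pw s (x + 2)))
           \<le> norm s * norm (s + 1) * x powr (- Re s - 2)"
proof -
  define f where "f = (\<lambda>t. pw s t - pw s (t + 1))"
  have "norm (f x - f (x + 1)) \<le> norm s * (norm (s + 1) * x powr (- Re s - 2)) * (x + 1 - x)"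
  proof (rule norm_diff_le_vector_derivative)
    fix t assume t: "x \<le> t" "t \<le> x + 1"
    have "((\<lambda>t. pw s (t + 1)) has_vector_derivative (1 *\<^sub>R (- s * pw (s + 1) (t + 1)))) (at t within {x..x + 1})"
      using x t by (intro vector_diff_chain_within[unfolded o_def] has_vector_derivative_pw)
        (auto intro!: derivative_eq_intros)
    then show "(f has_vector_derivative (- s * pw (s + 1) t - 1 *\<^sub>R (- s * pw (s + 1) (t + 1))))
        (at t within {x..x + 1})"
      unfolding f_def using x t by (intro has_vector_derivative_diff has_vector_derivative_pw) auto
    have "norm (pw (s + 1) t - pw (s + 1) (t + 1)) \<le> norm (s + 1) * t powr (- Re (s + 1) - 1) * (t + 1 - t)"
      using x t s by (intro norm_pw_diff) auto
    also have "\<dots> = norm (s + 1) * t powr (- Re s - 2)"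
      by (simp add: algebra_simps)
    also have "\<dots> \<le> norm (s + 1) * x powr (- Re s - 2)"
      using x t s by (auto intro!: mult_left_mono powr_mono2')
    finally have "norm s * norm (pw (s + 1) t - pw (s + 1) (t + 1)) \<le>
        norm s * (norm (s + 1) * x powr (- Re s - 2))"
      by (rule mult_left_mono) simp
    moreover have "- s * pw (s + 1) t - 1 *\<^sub>R (- s * pw (s + 1) (t + 1)) =
        - (s * (pw (s + 1) t - pw (s + 1) (t + 1)))"
      by (simp add: algebra_simps)
    ultimately show "norm (- s * pw (s + 1) t - 1 *\<^sub>R (- s * pw (s + 1) (t + 1))) \<le>
        norm s * (norm (s + 1) * x powr (- Re s - 2))"
      by (simp only: norm_minus_cancel norm_mult)
  qed simp
  moreover have "x + 1 + 1 = x + 2" by simp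
  ultimately show ?thesis by (simp add: f_def mult_ac)
qed

text \<open>Both terms of the difference are \<open>w - 1\<close> times an approximation of the integral of \<open>t powr (- w)\<close>
  over \<open>[x, x + 1]\<close>: the value at \<open>y\<close>, and the integral itself.  The factor \<open>w - 1\<close> keeps the
  second one free of the singularity at \<open>w = 1\<close>.\<close>

lemma norm_pw_integral_error:
  assumes x: "0 < x" and y: "x \<le> y" "y \<le> x + 1" and w: "-1 \<le> Re w"
  shows "norm ((w - 1) * pw w y - (pw (w - 1) x - pw (w - 1) (x + 1)))
           \<le> norm (w - 1) * norm w * x powr (- Re w - 1)"
proof -
  define f where "f = (\<lambda>t. pw (w - 1) t + t *\<^sub>R ((w - 1) * pw w y))"
  have "norm (f x - f (x + 1)) \<le> norm (w - 1) * (norm w * x powr (- Re w - 1)) * (x + 1 - x)"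
  proof (rule norm_diff_le_vector_derivative)
    fix t assume t: "x \<le> t" "t \<le> x + 1"
    show "(f has_vector_derivative (- (w - 1) * pw (w - 1 + 1) t + 1 *\<^sub>R ((w - 1) * pw w y)))
        (at t within {x..x + 1})"
      unfolding f_def using x t
      by (intro has_vector_derivative_add has_vector_derivative_pw)
         (auto intro!: derivative_eq_intros)
    define u v where "u = min t y" and "v = max t y"
    have uv: "x \<le> u" "u \<le> v" "v - u \<le> 1" using t y by (auto simp: u_def v_def)
    have "norm (pw w y - pw w t) = norm (pw w u - pw w v)"
      by (auto simp: u_def v_def min_def max_def norm_minus_commute)
    also have "\<dots> \<le> norm w * u powr (- Re w - 1) * (v - u)"
      using x uv w by (intro norm_pw_diff) auto
    also have "\<dots> \<le> norm w * x powr (- Re w - 1) * 1"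
      using x uv w by (intro mult_mono powr_mono2') auto
    finally have "norm (w - 1) * norm (pw w y - pw w t) \<le>
        norm (w - 1) * (norm w * x powr (- Re w - 1))"
      by (simp add: mult_left_mono)
    moreover have "- (w - 1) * pw (w - 1 + 1) t + 1 *\<^sub>R ((w - 1) * pw w y) =
        (w - 1) * (pw w y - pw w t)"
      by (simp add: algebra_simps)
    ultimately show "norm (- (w - 1) * pw (w - 1 + 1) t + 1 *\<^sub>R ((w - 1) * pw w y)) \<le>
        norm (w - 1) * (norm w * x powr (- Re w - 1))"
      by (simp only: norm_mult)
  qed simp
  then have "norm (f x - f (x + 1)) \<le> norm (w - 1) * norm w * x powr (- Re w - 1)"
    by (simp add: mult.assoc)
  moreover have "f x - f (x + 1) = - ((w - 1) * pw w y - (pw (w - 1) x - pw (w - 1) (x + 1)))"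
    by (simp add: f_def algebra_simps)
  ultimately show ?thesis by (simp only: norm_minus_cancel)
qed

lemma powr_neg_le:
  fixes x y :: real
  assumes "1 \<le> y" "y \<le> x" "0 \<le> \<delta>" "\<delta> \<le> \<sigma>"
  shows "x powr (- \<sigma>) \<le> y powr (- \<delta>)"
proof -
  have "x powr (- \<sigma>) \<le> y powr (- \<sigma>)" using assms by (intro powr_mono2') auto
  also have "\<dots> \<le> y powr (- \<delta>)" using assms by (intro powr_mono) auto
  finally show ?thesis .
qed

lemma summable_powr_neg:
  assumes "1 < c"
  shows "summable (\<lambda>n. real n powr (- c))" "summable (\<lambda>n. real (Suc n) powr (- c))"
proof -
  show s: "summable (\<lambda>n. real n powr (- c))"
    using assms by (simp add: summable_real_powr_iff)
  then show "summable (\<lambda>n. real (Suc n) powr (- c))"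
    by (subst summable_Suc_iff)
qed

section \<open>Continuation by Abel summation\<close>

definition half_spaces :: "real \<Rightarrow> real \<Rightarrow> (complex \<times> complex) set" where
  "half_spaces \<alpha> \<beta> = {p. \<alpha> < Re (fst p) \<and> \<beta> < Re (snd p)}"

lemma open_half_spaces: "open (half_spaces \<alpha> \<beta>)"
proof -
  have "half_spaces \<alpha> \<beta> = {s. Re s > \<alpha>} \<times> {s. Re s > \<beta>}"
    by (auto simp: half_spaces_def)
  then show ?thesis
    by (metis open_Times open_halfspace_Re_gt)
qed

lemma convex_half_spaces: "convex (half_spaces \<alpha> \<beta>)"
proof -
  have "half_spaces \<alpha> \<beta> = {s. Re s > \<alpha>} \<times> {s. Re s > \<beta>}"
    by (auto simp: half_spaces_def)
  then show ?thesis
    by (metis convex_Times convex_halfspace_Re_gt)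
qed

lemma locally_dominated_half_spacesI:
  assumes "\<And>\<delta>1 \<delta>2 K. \<alpha> < \<delta>1 \<Longrightarrow> \<beta> < \<delta>2 \<Longrightarrow> 0 < K \<Longrightarrow>
    \<exists>M. summable M \<and> (\<forall>s1 s2. \<delta>1 \<le> Re s1 \<longrightarrow> \<delta>2 \<le> Re s2 \<longrightarrow> norm s1 \<le> K \<longrightarrow> norm s2 \<le> K \<longrightarrow>
      (\<forall>n\<ge>1. norm (f n (s1, s2)) \<le> M n))"
  shows "locally_dominated f (half_spaces \<alpha> \<beta>)"
  unfolding locally_dominated_def
proof
  fix p assume p: "p \<in> half_spaces \<alpha> \<beta>"
  define \<delta>1 \<delta>2 where "\<delta>1 = (\<alpha> + Re (fst p)) / 2" and "\<delta>2 = (\<beta> + Re (snd p)) / 2"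
  define r where "r = min (Re (fst p) - \<delta>1) (Re (snd p) - \<delta>2)"
  define K where "K = norm p + r"
  have d: "\<alpha> < \<delta>1" "\<beta> < \<delta>2" "0 < r"
    using p by (auto simp: half_spaces_def \<delta>1_def \<delta>2_def r_def)
  have "0 < K" using d by (auto simp: K_def add_nonneg_pos)
  from assms[OF d(1,2) this] obtain M where M: "summable M"
    "\<And>s1 s2 n. \<delta>1 \<le> Re s1 \<Longrightarrow> \<delta>2 \<le> Re s2 \<Longrightarrow> norm s1 \<le> K \<Longrightarrow> norm s2 \<le> K \<Longrightarrow>
      n \<ge> 1 \<Longrightarrow> norm (f n (s1, s2)) \<le> M n"
    by blast
  have "norm (f n q) \<le> M n" if q: "q \<in> half_spaces \<alpha> \<beta> \<inter> ball p r" and n: "n \<ge> 1" for q n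
  proof -
    obtain s1 s2 where s: "q = (s1, s2)" by (cases q)
    have dq: "dist p q < r" using q by simp
    have "\<bar>Re (fst p) - Re s1\<bar> < r" "\<bar>Re (snd p) - Re s2\<bar> < r"
      using dq dist_fst_le[of p q] dist_snd_le[of p q]
        abs_Re_le_cmod[of "fst p - s1"] abs_Re_le_cmod[of "snd p - s2"]
      by (auto simp: s dist_norm)
    moreover have "norm q \<le> K"
      using dq norm_triangle_ineq2[of q p] by (simp add: K_def dist_norm norm_minus_commute)
    then have "norm s1 \<le> K" "norm s2 \<le> K"
      using norm_fst_le[of s1 s2] norm_snd_le[of s2 s1] by (auto simp: s)
    ultimately show ?thesis
      using M(2)[of s1 s2 n] n by (auto simp: s r_def)
  qed
  then show "\<exists>r>0. \<exists>M. summable M \<and>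
      (\<forall>q\<in>half_spaces \<alpha> \<beta> \<inter> ball p r. \<forall>n\<ge>1. norm (f n q) \<le> M n)"
    using d(3) M(1) by blast
qed

lemma holomorphic2_on_abel_sum:
  assumes U: "open U" and z: "norm z \<le> 1" and f: "\<And>n. f n holomorphic2_on U"
    and dom1: "z = 1 \<Longrightarrow> locally_dominated f U"
    and dom: "z \<noteq> 1 \<Longrightarrow> locally_dominated (\<lambda>n p. f n p - f (Suc n) p) U"
  shows "(\<lambda>p. abel_sum z (\<lambda>n. f n p)) holomorphic2_on U"
proof (cases "z = 1")
  case True
  then show ?thesis
    using holomorphic2_on_suminf[OF U f dom1] by (simp add: abel_sum_def)
next
  case False
  have "locally_dominated (\<lambda>n p. z ^ n * (f n p - f (Suc n) p)) U"
    unfolding locally_dominated_def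
  proof
    fix p assume "p \<in> U"
    then obtain r M where r: "r > 0" "summable M"
        "\<forall>q\<in>U \<inter> ball p r. \<forall>n\<ge>1. norm (f n q - f (Suc n) q) \<le> M n"
      using dom[OF False] unfolding locally_dominated_def by blast
    have "norm (z ^ n * c) \<le> norm c" for n c
      using z by (simp add: norm_mult norm_power mult_left_le_one_le power_le_one)
    then have "\<forall>q\<in>U \<inter> ball p r. \<forall>n\<ge>1. norm (z ^ n * (f n q - f (Suc n) q)) \<le> M n"
      using r(3) order_trans by blast
    then show "\<exists>r>0. \<exists>M. summable M \<and>
        (\<forall>q\<in>U \<inter> ball p r. \<forall>n\<ge>1. norm (z ^ n * (f n q - f (Suc n) q)) \<le> M n)"
      using r by blast
  qed
  then have "(\<lambda>p. \<Sum>n. z ^ n * (f n p - f (Suc n) p)) holomorphic2_on U"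
    by (intro holomorphic2_on_suminf U holomorphic2_on_mult holomorphic2_on_diff
          holomorphic2_on_const f)
  then have "(\<lambda>p. (f 0 p - z * (\<Sum>n. z ^ n * (f n p - f (Suc n) p))) * inverse (1 - z)) holomorphic2_on U"
    by (intro holomorphic2_on_mult holomorphic2_on_diff holomorphic2_on_const f)
  then show ?thesis
    using False by (simp add: abel_sum_def divide_inverse)
qed

text \<open>The Dirichlet series of \<open>z\<^sup>n\<close> is Abel summable in the half-plane to the right of this number, for
  every \<open>z\<close> with \<open>|z| \<le> 1\<close>.\<close>

definition abscissa :: "complex \<Rightarrow> real" where
  "abscissa z = (if z = 1 then 1 else 0)"

text \<open>The sum over \<open>n\<close> in the definition of the double zeta function, for the fixed outer index \<open>m\<close>.\<close>

definition tail_sum :: "real \<Rightarrow> complex \<Rightarrow> complex \<Rightarrow> nat \<Rightarrow> complex" where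
  "tail_sum a z s m = abel_sum z (\<lambda>n. pw s (real m + real (Suc n) + a))"

definition double_sum :: "real \<Rightarrow> complex \<Rightarrow> complex \<Rightarrow> complex \<times> complex \<Rightarrow> complex" where
  "double_sum a z1 z2 p = abel_sum z1 (\<lambda>m. pw (fst p) (real m + a) * tail_sum a z2 (snd p) m)"

context
  fixes a :: real
  assumes a: "0 < a"
begin

lemma norm_pw_le:
  assumes "y \<le> x" "1 \<le> y" "0 \<le> \<delta>" "\<delta> \<le> Re s"
  shows "norm (pw s x) \<le> y powr (- \<delta>)"
  using assms powr_neg_le[of y x \<delta> "Re s"] by (simp add: norm_pw)

lemma norm_pw_diff_le:
  assumes "y \<le> x" "1 \<le> y" "0 \<le> \<delta>" "\<delta> \<le> Re s" "norm s \<le> K" and x': "x' = x + 1"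
  shows "norm (pw s x - pw s x') \<le> K * y powr (- (\<delta> + 1))"
proof -
  have "norm (pw s x - pw s (x + 1)) \<le> norm s * x powr (- Re s - 1) * (x + 1 - x)"
    using assms by (intro norm_pw_diff) auto
  also have "\<dots> = norm s * x powr (- (Re s + 1))"
    by simp
  also have "\<dots> \<le> K * y powr (- (\<delta> + 1))"
    using assms powr_neg_le[of y x "\<delta> + 1" "Re s + 1"] order.trans[OF norm_ge_zero[of s] assms(5)]
    by (intro mult_mono) auto
  finally show ?thesis unfolding x' .
qed

lemma abel_summable_pw:
  assumes s: "abscissa z < Re s"
  shows "abel_summable z (\<lambda>n. pw s (real m + real (Suc n) + a))"
proof (cases "z = 1")
  case True
  have "norm (norm (pw s (real m + real (Suc n) + a))) \<le> real (Suc n) powr (- Re s)" for n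
    unfolding real_norm_def abs_norm_cancel using a s True by (intro norm_pw_le) (auto simp: abscissa_def)
  moreover have "summable (\<lambda>n. real (Suc n) powr (- Re s))"
    by (intro summable_powr_neg) (use s True in \<open>auto simp: abscissa_def\<close>)
  ultimately have "summable (\<lambda>n. norm (pw s (real m + real (Suc n) + a)))"
    by (rule summable_comparison_test'[where N = 0, rotated])
  then show ?thesis using True by (simp add: abel_summable_def)
next
  case False
  then have s: "0 < Re s" using s by (simp add: abscissa_def)
  have "norm (norm (pw s (real m + real (Suc n) + a) - pw s (real m + real (Suc (Suc n)) + a)))
      \<le> norm s * real (Suc n) powr (- (Re s + 1))" for n
    unfolding real_norm_def abs_norm_cancel using a s by (intro norm_pw_diff_le) auto
  moreover have "summable (\<lambda>n. norm s * real (Suc n) powr (- (Re s + 1)))"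
    using s by (intro summable_mult summable_powr_neg) auto
  ultimately have "summable (\<lambda>n. norm (pw s (real m + real (Suc n) + a) - pw s (real m + real (Suc (Suc n)) + a)))"
    by (rule summable_comparison_test'[where N = 0, rotated])
  then show ?thesis using False by (simp add: abel_summable_def)
qed

lemma tail_sum_bounded:
  assumes z: "norm z \<le> 1" and \<delta>: "abscissa z < \<delta>"
  obtains C where "0 \<le> C" "\<And>s m. \<delta> \<le> Re s \<Longrightarrow> norm s \<le> K \<Longrightarrow> norm (tail_sum a z s m) \<le> C"
proof (cases "z = 1")
  case True
  then have \<delta>: "1 < \<delta>" using \<delta> by (simp add: abscissa_def)
  note sm = summable_powr_neg(2)[OF \<delta>]
  show thesis
  proof
    show "0 \<le> (\<Sum>n. real (Suc n) powr (- \<delta>))"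
      by (intro suminf_nonneg sm) simp
    fix s m assume s: "\<delta> \<le> Re s"
    have le: "norm (pw s (real m + real (Suc n) + a)) \<le> real (Suc n) powr (- \<delta>)" for n
      using a s \<delta> by (intro norm_pw_le) auto
    have "norm (\<Sum>n. pw s (real m + real (Suc n) + a)) \<le> (\<Sum>n. real (Suc n) powr (- \<delta>))"
      by (rule norm_suminf_le[OF le sm])
    then show "norm (tail_sum a z s m) \<le> (\<Sum>n. real (Suc n) powr (- \<delta>))"
      using True by (simp add: tail_sum_def abel_sum_def)
  qed
next
  case False
  then have \<delta>: "0 < \<delta>" using \<delta> by (simp add: abscissa_def)
  have sm: "summable (\<lambda>n. real (Suc n) powr (- (\<delta> + 1)))"
    using \<delta> by (intro summable_powr_neg) auto
  define C where "C = (1 + (\<Sum>n. \<bar>K\<bar> * real (Suc n) powr (- (\<delta> + 1)))) / norm (1 - z)"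
  show thesis
  proof
    show "0 \<le> C"
      unfolding C_def by (intro divide_nonneg_nonneg add_nonneg_nonneg suminf_nonneg summable_mult sm) auto
    fix s m assume s: "\<delta> \<le> Re s" "norm s \<le> K"
    let ?f = "\<lambda>n. pw s (real m + real (Suc n) + a)"
    have sm': "abel_summable z ?f"
      using s \<delta> False by (intro abel_summable_pw) (auto simp: abscissa_def)
    have "norm (?f n - ?f (Suc n)) \<le> \<bar>K\<bar> * real (Suc n) powr (- (\<delta> + 1))" for n
      using a s \<delta> by (intro norm_pw_diff_le) auto
    then have "(\<Sum>n. norm (?f n - ?f (Suc n))) \<le> (\<Sum>n. \<bar>K\<bar> * real (Suc n) powr (- (\<delta> + 1)))"
      using sm' False by (intro suminf_le summable_mult sm) (auto simp: abel_summable_def)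
    moreover have "norm (?f 0) \<le> 1"
      using norm_pw_le[of 1 "real m + real (Suc 0) + a" \<delta> s] a s \<delta> by auto
    ultimately have "norm (abel_sum z ?f) \<le> C"
      unfolding C_def using False
      by (intro order.trans[OF norm_abel_sum_le[OF z False sm']] divide_right_mono add_mono) auto
    then show "norm (tail_sum a z s m) \<le> C"
      by (simp only: tail_sum_def)
  qed
qed

text \<open>For \<open>z = 1\<close> the difference is a single term.  For \<open>z \<noteq> 1\<close> it is the Abel sum of the first
  differences of the powers, which is bounded by their second differences
  \<open>O((m + n + a) powr (- \<delta> - 2))\<close>; half of this exponent is spent on \<open>m\<close> and half
  on \<open>n\<close>.\<close>

lemma tail_sum_diff_summable_bound:
  assumes z: "norm z \<le> 1" and \<delta>: "abscissa z < \<delta>"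
  obtains M where "summable M"
    "\<And>s m. \<delta> \<le> Re s \<Longrightarrow> norm s \<le> K \<Longrightarrow> norm (tail_sum a z s m - tail_sum a z s (Suc m)) \<le> M m"
proof (cases "z = 1")
  case True
  then have \<delta>: "1 < \<delta>" using \<delta> by (simp add: abscissa_def)
  show thesis
  proof
    show "summable (\<lambda>m. real (Suc m) powr (- \<delta>))"
      using \<delta> by (rule summable_powr_neg)
    fix s m assume s: "\<delta> \<le> Re s"
    let ?f = "\<lambda>n. pw s (real m + real (Suc n) + a)"
    have "summable ?f"
      using abel_summable_pw[of z s m] s \<delta> True
      by (auto simp: abel_summable_def abscissa_def intro: summable_norm_cancel simp del: of_nat_Suc)
    from suminf_split_head[OF this]
    have "tail_sum a z s m - tail_sum a z s (Suc m) = ?f 0"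
      using True by (simp add: tail_sum_def abel_sum_def add_ac)
    moreover have "norm (?f 0) \<le> real (Suc m) powr (- \<delta>)"
      using a s \<delta> by (intro norm_pw_le) auto
    ultimately show "norm (tail_sum a z s m - tail_sum a z s (Suc m)) \<le> real (Suc m) powr (- \<delta>)"
      by simp
  qed
next
  case False
  then have \<delta>: "0 < \<delta>" using \<delta> by (simp add: abscissa_def)
  \<comment> \<open>\<open>x powr (- \<delta> - 2) \<le> g m * g n\<close> when \<open>x\<close> exceeds both \<open>m + 1\<close> and \<open>n + 1\<close>\<close>
  define g where "g = (\<lambda>n. real (Suc n) powr (- (\<delta> / 2 + 1)))"
  have g: "summable g" "\<And>n. 0 \<le> g n"
    unfolding g_def by (intro summable_powr_neg) (use \<delta> in auto)
  define C where "C = (\<bar>K\<bar> + (\<Sum>n. \<bar>K\<bar> * (\<bar>K\<bar> + 1) * g n)) / norm (1 - z)"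
  show thesis
  proof
    show "summable (\<lambda>m. g m * C)" using g by (intro summable_mult2)
    fix s m assume s: "\<delta> \<le> Re s" "norm s \<le> K"
    let ?f = "\<lambda>n. pw s (real m + real (Suc n) + a)"
    let ?g = "\<lambda>n. pw s (real (Suc m) + real (Suc n) + a)"
    let ?h = "\<lambda>n. ?f n - ?g n"
    have sum_fg: "abel_summable z ?f" "abel_summable z ?g"
      using s \<delta> False by (intro abel_summable_pw; simp add: abscissa_def)+
    have diff: "tail_sum a z s m - tail_sum a z s (Suc m) = abel_sum z ?h"
      unfolding tail_sum_def by (rule abel_sum_diff[OF z sum_fg, symmetric])
    have h_le: "norm (?h n - ?h (Suc n)) \<le> g m * (\<bar>K\<bar> * (\<bar>K\<bar> + 1) * g n)" for n
    proof -
      define x where "x = real m + real (Suc n) + a"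
      have x: "real (Suc m) \<le> x" "real (Suc n) \<le> x" "0 < x" using a by (auto simp: x_def)
      have "norm (?h n - ?h (Suc n)) = norm ((pw s x - pw s (x + 1)) - (pw s (x + 1) - pw s (x + 2)))"
        by (simp add: x_def add_ac)
      also have "\<dots> \<le> norm s * norm (s + 1) * x powr (- Re s - 2)"
        using x s \<delta> by (intro norm_pw_diff2) auto
      also have "x powr (- Re s - 2) = x powr (- (Re s / 2 + 1)) * x powr (- (Re s / 2 + 1))"
        by (simp add: powr_add[symmetric])
      also have "norm s * norm (s + 1) * \<dots> \<le> \<bar>K\<bar> * (\<bar>K\<bar> + 1) * (g m * g n)"
      proof (intro mult_mono)
        show "norm s \<le> \<bar>K\<bar>" using s by simp
        show "norm (s + 1) \<le> \<bar>K\<bar> + 1" using s norm_triangle_ineq[of s 1] by simp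
        show "x powr (- (Re s / 2 + 1)) \<le> g m" "x powr (- (Re s / 2 + 1)) \<le> g n"
          unfolding g_def using x s \<delta> by (intro powr_neg_le; simp)+
      qed (use g in auto)
      finally show ?thesis by (simp add: mult_ac)
    qed
    have sum_b: "summable (\<lambda>n. g m * (\<bar>K\<bar> * (\<bar>K\<bar> + 1) * g n))"
      using g by (intro summable_mult)
    then have sum_h: "summable (\<lambda>n. norm (?h n - ?h (Suc n)))"
      by (rule summable_comparison_test'[where N = 0]) (use h_le in simp)
    have "(\<Sum>n. norm (?h n - ?h (Suc n))) \<le> (\<Sum>n. g m * (\<bar>K\<bar> * (\<bar>K\<bar> + 1) * g n))"
      by (rule suminf_le[OF h_le sum_h sum_b])
    also have "\<dots> = g m * (\<Sum>n. \<bar>K\<bar> * (\<bar>K\<bar> + 1) * g n)"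
      using g by (intro suminf_mult summable_mult)
    finally have 1: "(\<Sum>n. norm (?h n - ?h (Suc n))) \<le> g m * (\<Sum>n. \<bar>K\<bar> * (\<bar>K\<bar> + 1) * g n)" .
    have "norm (?h 0) \<le> \<bar>K\<bar> * real (Suc m) powr (- (\<delta> + 1))"
      using a s \<delta> by (intro norm_pw_diff_le) auto
    also have "\<dots> \<le> \<bar>K\<bar> * g m"
      unfolding g_def using \<delta> by (intro mult_left_mono powr_neg_le) auto
    finally have 2: "norm (?h 0) \<le> g m * \<bar>K\<bar>" by (simp add: mult.commute)
    have "abel_summable z ?h" using sum_h False by (simp add: abel_summable_def)
    from norm_abel_sum_le[OF z False this]
    have "norm (abel_sum z ?h) \<le> (g m * \<bar>K\<bar> + g m * (\<Sum>n. \<bar>K\<bar> * (\<bar>K\<bar> + 1) * g n)) / norm (1 - z)"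
      by (rule order.trans) (intro divide_right_mono add_mono 1 2 norm_ge_zero)
    then show "norm (tail_sum a z s m - tail_sum a z s (Suc m)) \<le> g m * C"
      unfolding diff by (simp add: C_def distrib_left)
  qed
qed

lemma holomorphic2_on_tail_sum:
  assumes z: "norm z \<le> 1"
  shows "(\<lambda>p. tail_sum a z (snd p) m) holomorphic2_on half_spaces \<alpha> (abscissa z)"
  unfolding tail_sum_def
proof (rule holomorphic2_on_abel_sum[OF open_half_spaces z])
  show "(\<lambda>p. pw (snd p) (real m + real (Suc n) + a)) holomorphic2_on half_spaces \<alpha> (abscissa z)" for n
    using a by (intro holomorphic2_on_pw holomorphic2_on_snd) (auto simp: add_nonneg_pos)
  show "locally_dominated (\<lambda>n p. pw (snd p) (real m + real (Suc n) + a)) (half_spaces \<alpha> (abscissa z))"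
    if "z = 1"
  proof (rule locally_dominated_half_spacesI)
    fix \<delta>1 \<delta> K :: real assume "abscissa z < \<delta>"
    then have \<delta>: "1 < \<delta>" using that by (simp add: abscissa_def)
    show "\<exists>M. summable M \<and> (\<forall>s1 s2. \<delta>1 \<le> Re s1 \<longrightarrow> \<delta> \<le> Re s2 \<longrightarrow> norm s1 \<le> K \<longrightarrow> norm s2 \<le> K \<longrightarrow>
      (\<forall>n\<ge>1. norm (pw (snd (s1, s2)) (real m + real (Suc n) + a)) \<le> M n))"
      using a \<delta> summable_powr_neg(2)[OF \<delta>]
      by (intro exI[of _ "\<lambda>n. real (Suc n) powr (- \<delta>)"] conjI allI impI) (auto intro!: norm_pw_le)
  qed
  show "locally_dominated (\<lambda>n p. pw (snd p) (real m + real (Suc n) + a) -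
      pw (snd p) (real m + real (Suc (Suc n)) + a)) (half_spaces \<alpha> (abscissa z))"
    if "z \<noteq> 1"
  proof (rule locally_dominated_half_spacesI)
    fix \<delta>1 \<delta> K :: real assume "abscissa z < \<delta>"
    then have \<delta>: "0 < \<delta>" using that by (simp add: abscissa_def)
    have "norm (pw s (real m + real (Suc n) + a) - pw s (real m + real (Suc (Suc n)) + a))
        \<le> K * real (Suc n) powr (- (\<delta> + 1))" if "\<delta> \<le> Re s" "norm s \<le> K" for s n
      using a that \<delta> by (intro norm_pw_diff_le) auto
    moreover have "summable (\<lambda>n. K * real (Suc n) powr (- (\<delta> + 1)))"
      using \<delta> by (intro summable_mult summable_powr_neg) auto
    ultimately show "\<exists>M. summable M \<and> (\<forall>s1 s2. \<delta>1 \<le> Re s1 \<longrightarrow> \<delta> \<le> Re s2 \<longrightarrow> norm s1 \<le> K \<longrightarrow> norm s2 \<le> K \<longrightarrow>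
      (\<forall>n\<ge>1. norm (pw (snd (s1, s2)) (real m + real (Suc n) + a) -
          pw (snd (s1, s2)) (real m + real (Suc (Suc n)) + a)) \<le> M n))"
      by (intro exI[of _ "\<lambda>n. K * real (Suc n) powr (- (\<delta> + 1))"]) (simp del: of_nat_Suc)
  qed
qed

text \<open>Boundedness of the inner sums suffices for \<open>z1 = 1\<close>.  For \<open>z1 \<noteq> 1\<close> the first differences in \<open>m\<close>
  have to be summable, and the product rule for differences reduces this to the first
  differences of the inner sums and of the powers.\<close>

lemma holomorphic2_on_double_sum:
  assumes z1: "norm z1 \<le> 1" and z2: "norm z2 \<le> 1"
  shows "double_sum a z1 z2 holomorphic2_on half_spaces (abscissa z1) (abscissa z2)"
proof -
  let ?U = "half_spaces (abscissa z1) (abscissa z2)"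
  let ?f = "\<lambda>m p. pw (fst p) (real m + a) * tail_sum a z2 (snd p) m"
  have "(\<lambda>p. abel_sum z1 (\<lambda>m. ?f m p)) holomorphic2_on ?U"
  proof (rule holomorphic2_on_abel_sum[OF open_half_spaces z1])
    show "?f m holomorphic2_on ?U" for m
      using a by (intro holomorphic2_on_mult holomorphic2_on_tail_sum z2 holomorphic2_on_pw holomorphic2_on_fst)
        (auto simp: add_nonneg_pos)
    show "locally_dominated ?f ?U" if "z1 = 1"
    proof (rule locally_dominated_half_spacesI)
      fix \<delta>1 \<delta>2 K :: real assume \<delta>: "abscissa z1 < \<delta>1" "abscissa z2 < \<delta>2"
      obtain C where C: "0 \<le> C" "\<And>s m. \<delta>2 \<le> Re s \<Longrightarrow> norm s \<le> K \<Longrightarrow> norm (tail_sum a z2 s m) \<le> C"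
        using tail_sum_bounded[OF z2 \<delta>(2), where K = K] by blast
      have \<delta>1: "1 < \<delta>1" using \<delta> that by (simp add: abscissa_def)
      have "norm (?f m (s1, s2)) \<le> real m powr (- \<delta>1) * C"
        if "\<delta>1 \<le> Re s1" "\<delta>2 \<le> Re s2" "norm s2 \<le> K" "m \<ge> 1" for s1 s2 m
        unfolding norm_mult fst_conv snd_conv using a that \<delta>1 C
        by (intro mult_mono norm_pw_le) auto
      moreover have "summable (\<lambda>m. real m powr (- \<delta>1) * C)"
        using \<delta>1 by (intro summable_mult2 summable_powr_neg)
      ultimately show "\<exists>M. summable M \<and> (\<forall>s1 s2. \<delta>1 \<le> Re s1 \<longrightarrow> \<delta>2 \<le> Re s2 \<longrightarrow>
          norm s1 \<le> K \<longrightarrow> norm s2 \<le> K \<longrightarrow> (\<forall>m\<ge>1. norm (?f m (s1, s2)) \<le> M m))"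
        by (intro exI[of _ "\<lambda>m. real m powr (- \<delta>1) * C"] conjI allI impI) auto
    qed
    show "locally_dominated (\<lambda>m p. ?f m p - ?f (Suc m) p) ?U" if "z1 \<noteq> 1"
    proof (rule locally_dominated_half_spacesI)
      fix \<delta>1 \<delta>2 K :: real assume \<delta>: "abscissa z1 < \<delta>1" "abscissa z2 < \<delta>2" and K: "0 < K"
      obtain C where C: "0 \<le> C" "\<And>s m. \<delta>2 \<le> Re s \<Longrightarrow> norm s \<le> K \<Longrightarrow> norm (tail_sum a z2 s m) \<le> C"
        using tail_sum_bounded[OF z2 \<delta>(2), where K = K] by blast
      obtain M where M: "summable M" "\<And>s m. \<delta>2 \<le> Re s \<Longrightarrow> norm s \<le> K \<Longrightarrow>
          norm (tail_sum a z2 s m - tail_sum a z2 s (Suc m)) \<le> M m"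
        using tail_sum_diff_summable_bound[OF z2 \<delta>(2), where K = K] by blast
      have \<delta>1: "0 < \<delta>1" using \<delta> that by (simp add: abscissa_def)
      have "norm (?f m (s1, s2) - ?f (Suc m) (s1, s2)) \<le> M m + K * real m powr (- (\<delta>1 + 1)) * C"
        if s: "\<delta>1 \<le> Re s1" "\<delta>2 \<le> Re s2" "norm s1 \<le> K" "norm s2 \<le> K" and m: "m \<ge> 1" for s1 s2 m
      proof -
        let ?p = "pw s1 (real m + a)" and ?q = "pw s1 (real m + a + 1)"
        have "?f m (s1, s2) - ?f (Suc m) (s1, s2) =
            ?p * (tail_sum a z2 s2 m - tail_sum a z2 s2 (Suc m)) + (?p - ?q) * tail_sum a z2 s2 (Suc m)"
          by (simp add: algebra_simps)
        also have "norm \<dots> \<le> 1 * M m + (K * real m powr (- (\<delta>1 + 1))) * C"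
        proof (rule norm_triangle_mono)
          have "norm ?p \<le> 1"
            using norm_pw_le[of 1 "real m + a" \<delta>1 s1] a s m \<delta>1 by simp
          then show "norm (?p * (tail_sum a z2 s2 m - tail_sum a z2 s2 (Suc m))) \<le> 1 * M m"
            unfolding norm_mult using s by (intro mult_mono M) auto
          have "norm (?p - ?q) \<le> K * real m powr (- (\<delta>1 + 1))"
            using a s m \<delta>1 by (intro norm_pw_diff_le) auto
          then show "norm ((?p - ?q) * tail_sum a z2 s2 (Suc m)) \<le> K * real m powr (- (\<delta>1 + 1)) * C"
            unfolding norm_mult using s K by (intro mult_mono C) auto
        qed
        finally show ?thesis by simp
      qed
      moreover have "summable (\<lambda>m. M m + K * real m powr (- (\<delta>1 + 1)) * C)"
        using \<delta>1 M by (intro summable_add summable_mult2 summable_mult summable_powr_neg) auto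
      ultimately show "\<exists>M. summable M \<and> (\<forall>s1 s2. \<delta>1 \<le> Re s1 \<longrightarrow> \<delta>2 \<le> Re s2 \<longrightarrow>
          norm s1 \<le> K \<longrightarrow> norm s2 \<le> K \<longrightarrow>
          (\<forall>m\<ge>1. norm (?f m (s1, s2) - ?f (Suc m) (s1, s2)) \<le> M m))"
        by (intro exI[of _ "\<lambda>m. M m + K * real m powr (- (\<delta>1 + 1)) * C"] conjI allI impI)
    qed
  qed
  then show ?thesis
    unfolding double_sum_def .
qed

lemma Phi2_series_eq_pw:
  "Phi2_series s1 s2 a z1 z2 =
     (\<Sum>m. z1 ^ m * (pw s1 (real m + a) * (\<Sum>n. z2 ^ n * pw s2 (real m + real (Suc n) + a))))"
  unfolding Phi2_series_def divide_powr_eq_pw by (simp only: mult.assoc)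

lemma summable_pw_tail_sum:
  assumes z: "norm z \<le> 1" and s: "1 < Re s1" "abscissa z < Re s2"
  shows "summable (\<lambda>m. norm (pw s1 (real m + a) * tail_sum a z s2 m))"
proof -
  obtain C where C: "0 \<le> C" "\<And>s m. Re s2 \<le> Re s \<Longrightarrow> norm s \<le> norm s2 \<Longrightarrow>
      norm (tail_sum a z s m) \<le> C"
    using tail_sum_bounded[OF z s(2), where K = "norm s2"] by blast
  show ?thesis
  proof (rule summable_comparison_test'[where N = 1])
    show "summable (\<lambda>m. real m powr (- Re s1) * C)"
      using s by (intro summable_mult2 summable_powr_neg)
    show "norm (norm (pw s1 (real m + a) * tail_sum a z s2 m)) \<le> real m powr (- Re s1) * C"
      if "m \<ge> 1" for m
      unfolding norm_mult using a s that C
      by (simp add: abs_mult) (intro mult_mono norm_pw_le; simp)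
  qed
qed

lemma double_sum_eq_series:
  assumes z: "z1 \<noteq> 0" "norm z1 \<le> 1" "z2 \<noteq> 0" "norm z2 \<le> 1" and s: "1 < Re s1" "1 < Re s2"
  shows "double_sum a z1 z2 (s1, s2) = Phi2_series s1 s2 a z1 z2"
proof -
  have "summable (\<lambda>n. norm (pw s2 (real m + real (Suc n) + a)))" for m
    using abel_summable_pw[of 1 s2 m] s by (simp add: abel_summable_def abscissa_def)
  then have inner: "tail_sum a z2 s2 m = (\<Sum>n. z2 ^ n * pw s2 (real m + real (Suc n) + a))" for m
    unfolding tail_sum_def using z by (intro abel_sum_eq_suminf summable_power_mult)
  have "abscissa z2 < Re s2" using s by (simp add: abscissa_def)
  then have "summable (\<lambda>m. norm (pw s1 (real m + a) * tail_sum a z2 s2 m))"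
    using z s by (intro summable_pw_tail_sum)
  then have "double_sum a z1 z2 (s1, s2) = (\<Sum>m. z1 ^ m * (pw s1 (real m + a) * tail_sum a z2 s2 m))"
    unfolding double_sum_def using z by (simp add: abel_sum_eq_suminf summable_power_mult)
  then show ?thesis
    unfolding Phi2_series_eq_pw inner .
qed

lemma Phi2_eq_double_sum:
  assumes z: "z1 \<noteq> 0" "norm z1 \<le> 1" "z2 \<noteq> 0" "norm z2 \<le> 1"
    and s: "abscissa z1 < Re s1" "abscissa z2 < Re s2"
  shows "Phi2 s1 s2 a z1 z2 = double_sum a z1 z2 (s1, s2)"
proof (rule Phi2_eqI)
  let ?U = "half_spaces (abscissa z1) (abscissa z2)"
  show "open ?U" "convex ?U" "open ?U" "?U \<subseteq> ?U"
    by (auto intro: open_half_spaces convex_half_spaces)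
  show "Phi2_conv \<subseteq> ?U"
    by (auto simp: Phi2_conv_def half_spaces_def abscissa_def)
  show "double_sum a z1 z2 holomorphic2_on ?U"
    using z by (intro holomorphic2_on_double_sum)
  then show "double_sum a z1 z2 meromorphic2_on ?U"
    by (rule holomorphic2_imp_meromorphic2_on[OF open_half_spaces])
  show "(s1, s2) \<in> ?U" using s by (simp add: half_spaces_def)
  show "double_sum a z1 z2 (w1, w2) = Phi2_series w1 w2 a z1 z2" if "(w1, w2) \<in> Phi2_conv" for w1 w2
    using that z by (intro double_sum_eq_series) (auto simp: Phi2_conv_def)
qed

end

section \<open>Nonvanishing of Abel double sums\<close>

fun pdiff :: "nat \<Rightarrow> real \<Rightarrow> real \<Rightarrow> real" where
  "pdiff 0 \<sigma> x = x powr (- \<sigma>)"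
| "pdiff (Suc k) \<sigma> x = pdiff k \<sigma> x - pdiff k \<sigma> (x + 1)"

lemma pdiff_has_derivative:
  assumes "0 < x"
  shows "(pdiff k \<sigma> has_real_derivative - \<sigma> * pdiff k (\<sigma> + 1) x) (at x)"
  using assms
proof (induction k arbitrary: x)
  case 0
  then have "((\<lambda>x. x powr (- \<sigma>)) has_real_derivative (- \<sigma> * x powr (- \<sigma> - 1))) (at x)"
    by (rule has_real_derivative_powr)
  then show ?case by simp
next
  case (Suc k)
  have "((\<lambda>x. pdiff k \<sigma> (x + 1)) has_real_derivative - \<sigma> * pdiff k (\<sigma> + 1) (x + 1)) (at x)"
    using Suc.IH[of "x + 1"] Suc.prems by (simp add: DERIV_shift)
  from DERIV_diff[OF Suc.IH[OF Suc.prems] this] show ?case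
    by (simp add: algebra_simps)
qed

text \<open>The derivative of the \<open>k\<close>-th difference with exponent \<open>\<sigma>\<close> is \<open>- \<sigma>\<close> times the one
  with exponent \<open>\<sigma> + 1\<close>, so induction on \<open>k\<close> over all exponents yields monotonicity of the \<open>k\<close>-th
  difference and with it the sign of the next one.\<close>

lemma pdiff_nonneg:
  assumes "0 < x" "0 \<le> \<sigma>"
  shows "0 \<le> pdiff k \<sigma> x"
  using assms
proof (induction k arbitrary: \<sigma> x)
  case (Suc k)
  have "pdiff k \<sigma> (x + 1) \<le> pdiff k \<sigma> x"
  proof (rule DERIV_nonpos_imp_nonincreasing[where f = "pdiff k \<sigma>"])
    fix y assume "x \<le> y"
    then have y: "0 < y" using Suc.prems by simp
    show "\<exists>D. (pdiff k \<sigma> has_real_derivative D) (at y) \<and> D \<le> 0"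
      using pdiff_has_derivative[OF y] Suc.IH[OF y, of "\<sigma> + 1"] Suc.prems
      by (intro exI[of _ "- \<sigma> * pdiff k (\<sigma> + 1) y"]) simp
  qed simp
  then show ?case by simp
qed simp

lemma convex_seq_pdiff:
  assumes "0 < x" "0 \<le> \<sigma>"
  shows "convex_seq (\<lambda>n. pdiff k \<sigma> (x + real n))"
  unfolding convex_seq_def
proof
  fix n
  have "0 < x + real n" using assms by simp
  from pdiff_nonneg[OF this assms(2)]
  have "0 \<le> pdiff k \<sigma> (x + real n)" "0 \<le> pdiff (Suc k) \<sigma> (x + real n)"
    "0 \<le> pdiff (Suc (Suc k)) \<sigma> (x + real n)"
    by blast+
  then show "0 \<le> pdiff k \<sigma> (x + real n) \<and> pdiff k \<sigma> (x + real (Suc n)) \<le> pdiff k \<sigma> (x + real n) \<and>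
      2 * pdiff k \<sigma> (x + real (Suc n)) \<le> pdiff k \<sigma> (x + real n) + pdiff k \<sigma> (x + real (Suc (Suc n)))"
    by (simp add: add_ac)
qed

lemma summable_pdiff:
  assumes "0 < x" "1 < \<sigma>"
  shows "summable (\<lambda>n. pdiff k \<sigma> (x + real n))"
  using assms(1)
proof (induction k arbitrary: x)
  case 0
  have "summable (\<lambda>n. real n powr (- \<sigma>))"
    using assms(2) by (rule summable_powr_neg)
  then show ?case
  proof (rule summable_comparison_test'[where N = 1])
    fix n :: nat assume "1 \<le> n"
    then show "norm (pdiff 0 \<sigma> (x + real n)) \<le> real n powr (- \<sigma>)"
      using 0 assms(2) by (auto intro!: powr_mono2')
  qed
next
  case (Suc k)
  from summable_diff[OF Suc.IH[of x] Suc.IH[of "x + 1"]] Suc.prems show ?case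
    by (simp add: add_ac)
qed

text \<open>Taking differences in \<open>m\<close> of the inner sums amounts to taking differences of the powers inside
  them.  These are again decreasing and convex in \<open>n\<close>, so that the real part of every such difference is
  nonnegative and the imaginary part has the sign of \<open>Im z\<close>.  Hence the real part and, up to the sign
  \<open>\<epsilon>\<close>, the imaginary part of the inner sum are themselves decreasing convex sequences in \<open>m\<close>.\<close>

lemma tail_sum_eq_convex_seqs:
  assumes a: "0 < a" and z: "z \<noteq> 0" "norm z \<le> 1" and \<sigma>: "abscissa z < \<sigma>"
  obtains B C \<epsilon> where "convex_seq B" "convex_seq C" "0 < B 0" "\<epsilon> = 1 \<or> \<epsilon> = -1"
    "\<And>m. tail_sum a z (of_real \<sigma>) m = of_real (B m) + of_real \<epsilon> * \<i> * of_real (C m)"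
proof -
  have \<sigma>0: "0 < \<sigma>" and \<sigma>1: "z = 1 \<Longrightarrow> 1 < \<sigma>"
    using \<sigma> by (auto simp: abscissa_def split: if_splits)
  define x where "x m = real m + 1 + a" for m
  have x: "0 < x m" "x (Suc m) = x m + 1" for m using a by (auto simp: x_def)
  define g where "g k m = (\<lambda>n. pdiff k \<sigma> (x m + real n))" for k m
  define T where "T k m = abel_sum z (\<lambda>n. of_real (g k m n))" for k m
  define \<epsilon> :: real where "\<epsilon> = (if 0 \<le> Im z then 1 else -1)"
  define B where "B m = Re (T 0 m)" for m
  define C where "C m = \<epsilon> * Im (T 0 m)" for m
  have conv: "convex_seq (g k m)" and sm: "z = 1 \<Longrightarrow> summable (g k m)" for k m
    unfolding g_def using x \<sigma>0 \<sigma>1 by (auto intro!: convex_seq_pdiff summable_pdiff)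
  have abs: "abel_summable z (\<lambda>n. of_real (g k m n))" for k m
    using conv sm by (rule convex_seq_abel_summable)
  have T_diff: "T (Suc k) m = T k m - T k (Suc m)" for k m
    unfolding T_def abel_sum_diff[OF z(2) abs abs, symmetric]
    by (rule abel_sum_cong) (simp add: g_def x(2) add_ac)
  have T: "g k m 0 / 2 \<le> Re (T k m)" "0 \<le> \<epsilon> * Im (T k m)" for k m
    unfolding T_def \<epsilon>_def using abel_sum_convex_seq[of "g k m", OF conv sm z] by auto
  have pos: "0 \<le> Re (T k m)" for k m
    using T(1)[of k m] convex_seqD(1)[OF conv[of k m], of 0] by linarith
  have "convex_seq B"
    unfolding convex_seq_def B_def
    using pos[of 0] pos[of "Suc 0"] pos[of "Suc (Suc 0)"] by (simp add: T_diff)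
  moreover have "convex_seq C"
    unfolding convex_seq_def C_def
    using T(2)[of 0] T(2)[of "Suc 0"] T(2)[of "Suc (Suc 0)"] by (simp add: T_diff algebra_simps)
  moreover have "0 < B 0"
  proof -
    have "0 < g 0 0 0" using x(1)[of 0] by (simp add: g_def)
    then show ?thesis using T(1)[of 0 0] by (simp add: B_def)
  qed
  moreover have "\<epsilon> = 1 \<or> \<epsilon> = -1" by (simp add: \<epsilon>_def)
  moreover have "tail_sum a z (of_real \<sigma>) m = of_real (B m) + of_real \<epsilon> * \<i> * of_real (C m)" for m
  proof -
    have "tail_sum a z (of_real \<sigma>) m = T 0 m"
      unfolding tail_sum_def T_def
    proof (rule abel_sum_cong)
      fix n
      have "0 < real m + real (Suc n) + a" using a by simp
      moreover have "real m + real (Suc n) + a = x m + real n" by (simp add: x_def)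
      ultimately show "pw (of_real \<sigma>) (real m + real (Suc n) + a) = of_real (g 0 m n)"
        by (simp only: pw_of_real g_def pdiff.simps)
    qed
    moreover have "\<epsilon> * \<epsilon> = 1" by (simp add: \<epsilon>_def)
    ultimately show ?thesis
      by (simp add: complex_eq_iff B_def C_def mult.assoc[symmetric])
  qed
  ultimately show thesis by (rule that)
qed

text \<open>With the splitting \<open>B + i \<epsilon> C\<close> of the inner sums, the double sum is \<open>X + i \<epsilon> Y\<close>, where \<open>X\<close> and \<open>Y\<close> are
  Abel sums at \<open>z1\<close> of decreasing convex sequences and so lie in one quarter plane
  \<open>{Re \<ge> 0, \<plusminus> Im \<ge> 0}\<close>, with \<open>Re X > 0\<close>.  If the sum vanished, then \<open>X\<close> would be \<open>Y\<close>
  turned by a right angle.  One of the two directions is incompatible with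
  \<open>Re X > 0\<close>; the other forces \<open>Re Y = 0\<close>, whence \<open>C = 0\<close>, \<open>Y = 0\<close> and \<open>X = 0\<close>.\<close>

lemma double_sum_nonzero:
  assumes a: "0 < a" and z1: "z1 \<noteq> 0" "norm z1 \<le> 1" and z2: "z2 \<noteq> 0" "norm z2 \<le> 1"
    and \<sigma>: "abscissa z1 < \<sigma>1" "abscissa z2 < \<sigma>2"
  shows "double_sum a z1 z2 (of_real \<sigma>1, of_real \<sigma>2) \<noteq> 0"
proof
  assume zero: "double_sum a z1 z2 (of_real \<sigma>1, of_real \<sigma>2) = 0"
  obtain B C \<epsilon> where B: "convex_seq B" "0 < B 0" and C: "convex_seq C" and \<epsilon>: "\<epsilon> = 1 \<or> \<epsilon> = -1"
    and L: "\<And>m. tail_sum a z2 (of_real \<sigma>2) m = of_real (B m) + of_real \<epsilon> * \<i> * of_real (C m)"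
    using tail_sum_eq_convex_seqs[OF a z2 \<sigma>(2)] by metis
  have \<sigma>1: "0 < \<sigma>1" "z1 = 1 \<Longrightarrow> 1 < \<sigma>1"
    using \<sigma> by (auto simp: abscissa_def split: if_splits)
  define h where "h = (\<lambda>m. pdiff 0 \<sigma>1 (a + real m))"
  have h: "convex_seq h" "0 < h 0"
    unfolding h_def using a \<sigma>1 by (auto intro!: convex_seq_pdiff simp del: pdiff.simps) (simp)
  have smooth: "convex_seq (\<lambda>m. h m * D m)" "z1 = 1 \<Longrightarrow> summable (\<lambda>m. h m * D m)"
    if D: "convex_seq D" for D
  proof -
    show "convex_seq (\<lambda>m. h m * D m)" by (rule convex_seq_mult[OF h(1) D])
    assume "z1 = 1"
    then have "summable (\<lambda>m. h m * D 0)"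
      unfolding h_def using a \<sigma>1 by (intro summable_mult2 summable_pdiff)
    then show "summable (\<lambda>m. h m * D m)"
      by (rule summable_comparison_test'[where N = 0])
        (use convex_seqD(1)[OF D] convex_seqD(1)[OF h(1)] convex_seq_le_0[OF D] in
          \<open>auto simp: abs_mult intro!: mult_left_mono\<close>)
  qed
  define S where "S D = abel_sum z1 (\<lambda>m. of_real (h m * D m))" for D :: "nat \<Rightarrow> real"
  have S: "h 0 * D 0 / 2 \<le> Re (S D)" "0 \<le> Im z1 \<Longrightarrow> 0 \<le> Im (S D)" "Im z1 \<le> 0 \<Longrightarrow> Im (S D) \<le> 0"
    if "convex_seq D" for D
    unfolding S_def using abel_sum_convex_seq[OF smooth[OF that] z1] by auto
  have sm: "abel_summable z1 (\<lambda>m. of_real (h m * D m))" if "convex_seq D" for D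
    by (rule convex_seq_abel_summable[OF smooth[OF that]])
  have "double_sum a z1 z2 (of_real \<sigma>1, of_real \<sigma>2) =
      abel_sum z1 (\<lambda>m. of_real (h m * B m) + of_real \<epsilon> * \<i> * of_real (h m * C m))"
    unfolding double_sum_def fst_conv snd_conv L
  proof (rule abel_sum_cong)
    fix m
    have "pw (of_real \<sigma>1) (real m + a) = of_real (h m)"
      using a by (simp add: h_def pw_of_real add_nonneg_pos add.commute)
    then show "pw (of_real \<sigma>1) (real m + a) * (of_real (B m) + of_real \<epsilon> * \<i> * of_real (C m)) =
        of_real (h m * B m) + of_real \<epsilon> * \<i> * of_real (h m * C m)"
      by (simp add: algebra_simps)
  qed
  also have "\<dots> = S B + of_real \<epsilon> * \<i> * S C"
    unfolding S_def
    by (simp only: abel_sum_add[OF z1(2) sm[OF B(1)] abel_summable_cmult[OF sm[OF C]]]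
        abel_sum_cmult[OF z1(2) sm[OF C]])
  finally have "S B + of_real \<epsilon> * \<i> * S C = 0" using zero by simp
  then have eq: "Re (S B) = \<epsilon> * Im (S C)" "Im (S B) = - \<epsilon> * Re (S C)"
    by (auto simp: complex_eq_iff)
  have "0 < h 0 * B 0" using h B by simp
  then have SB: "0 < Re (S B)" using S(1)[OF B(1)] by linarith
  have "Re (S C) \<le> 0"
    using \<epsilon> eq SB S(2,3)[OF B(1)] S(2,3)[OF C] by (cases "0 \<le> Im z1") auto
  then have "h 0 * C 0 \<le> 0" using S(1)[OF C] by linarith
  then have "C 0 \<le> 0" using h by (simp add: mult_le_0_iff)
  then have "C m = 0" for m
    using convex_seqD(1)[OF C, of m] convex_seq_le_0[OF C, of m] by linarith
  then have "S C = 0" by (simp add: S_def abel_sum_def)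
  then show False using eq SB by simp
qed

section \<open>Continuation across the polar line\<close>

text \<open>For \<open>z1 = z2 = 1\<close> sums are compared with integrals.  \<open>left_error\<close> and \<open>right_error\<close> are, up to the
  factors \<open>w - 1\<close> and \<open>1 - w\<close>, the errors in replacing the integral of \<open>t powr (- w)\<close> over
  \<open>[x, x + 1]\<close> by the value at the left and at the right endpoint.\<close>

definition left_error :: "complex \<Rightarrow> real \<Rightarrow> complex" where
  "left_error w x = (w - 1) * pw w x - (pw (w - 1) x - pw (w - 1) (x + 1))"

definition right_error :: "complex \<Rightarrow> real \<Rightarrow> complex" where
  "right_error w x = (pw (w - 1) x - pw (w - 1) (x + 1)) - (w - 1) * pw w (x + 1)"

text \<open>This is \<open>(w - 1) \<zeta>(w, a)\<close> for the Hurwitz zeta function, in a form that converges for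
  \<open>Re w > 0\<close>; see \<open>zeta_num_eq\<close>.\<close>

definition zeta_num :: "real \<Rightarrow> complex \<Rightarrow> complex" where
  "zeta_num a w = pw (w - 1) a + (\<Sum>m. left_error w (real m + a))"

text \<open>By \<open>gap_eq\<close> this is \<open>s - 1\<close> times the excess of the integral of \<open>t powr (- s)\<close> over
  \<open>[m + a, \<infinity>)\<close> over the inner sum, which starts at \<open>m + a + 1\<close>.\<close>

definition gap :: "real \<Rightarrow> complex \<Rightarrow> nat \<Rightarrow> complex" where
  "gap a s m = (\<Sum>n. right_error s (real m + a + real n))"

definition gap_sum :: "real \<Rightarrow> complex \<times> complex \<Rightarrow> complex" where
  "gap_sum a p = (\<Sum>m. pw (fst p) (real m + a) * gap a (snd p) m)"

text \<open>Replacing the inner sums by integrals turns \<open>(s2 - 1) \<Phi>\<^sub>2\<close> into \<open>\<zeta>(w, a)\<close> with \<open>w = s1 + s2 - 1\<close>, and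
  \<open>gap_sum\<close> is the error: \<open>(s2 - 1) \<Phi>\<^sub>2 = \<zeta>(w, a) - gap_sum\<close>.  The next two definitions multiply this
  by \<open>w - 1 = s1 + s2 - 2\<close> to isolate the pole.\<close>

definition double_zeta_num :: "real \<Rightarrow> complex \<times> complex \<Rightarrow> complex" where
  "double_zeta_num a p =
     zeta_num a (fst p + snd p - 1) - (fst p + snd p - 2) * gap_sum a p"

definition double_zeta :: "real \<Rightarrow> complex \<times> complex \<Rightarrow> complex" where
  "double_zeta a p = double_zeta_num a p / ((fst p + snd p - 2) * (snd p - 1))"

lemma norm_left_error:
  assumes "1 \<le> y" "y \<le> x" "0 \<le> \<delta>" "\<delta> \<le> Re w" "norm w \<le> K"
  shows "norm (left_error w x) \<le> (K + 1) * K * y powr (- (\<delta> + 1))"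
proof -
  have K: "0 \<le> K" using assms(5) norm_ge_zero[of w] by linarith
  have "norm (left_error w x) \<le> norm (w - 1) * norm w * x powr (- Re w - 1)"
    unfolding left_error_def using assms by (intro norm_pw_integral_error) auto
  also have "\<dots> = norm (w - 1) * norm w * x powr (- (Re w + 1))" by simp
  also have "\<dots> \<le> (K + 1) * K * y powr (- (\<delta> + 1))"
    using assms K norm_triangle_ineq4[of w 1] by (intro mult_mono powr_neg_le) auto
  finally show ?thesis .
qed

lemma norm_right_error:
  assumes "1 \<le> y" "y \<le> x" "0 \<le> \<delta>" "\<delta> \<le> Re w" "norm w \<le> K"
  shows "norm (right_error w x) \<le> (K + 1) * K * y powr (- (\<delta> + 1))"
proof -
  have K: "0 \<le> K" using assms(5) norm_ge_zero[of w] by linarith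
  have "norm (right_error w x) = norm ((w - 1) * pw w (x + 1) - (pw (w - 1) x - pw (w - 1) (x + 1)))"
    unfolding right_error_def by (rule norm_minus_commute)
  also have "\<dots> \<le> norm (w - 1) * norm w * x powr (- Re w - 1)"
    using assms by (intro norm_pw_integral_error) auto
  also have "\<dots> = norm (w - 1) * norm w * x powr (- (Re w + 1))" by simp
  also have "\<dots> \<le> (K + 1) * K * y powr (- (\<delta> + 1))"
    using assms K norm_triangle_ineq4[of w 1] by (intro mult_mono powr_neg_le) auto
  finally show ?thesis .
qed

lemma tendsto_pw_0:
  assumes "0 < Re s"
  shows "(\<lambda>n. pw s (x + real n)) \<longlonglongrightarrow> 0"
proof (rule tendsto_norm_zero_cancel)
  have lim: "filterlim (\<lambda>n. x + real n) at_top sequentially"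
    by (intro filterlim_tendsto_add_at_top[OF tendsto_const] filterlim_real_sequentially)
  then have "eventually (\<lambda>n. 0 < x + real n) sequentially"
    unfolding filterlim_at_top_dense by blast
  then have "eventually (\<lambda>n. (x + real n) powr (- Re s) = norm (pw s (x + real n))) sequentially"
    by eventually_elim (simp add: norm_pw)
  moreover have "(\<lambda>n. (x + real n) powr (- Re s)) \<longlonglongrightarrow> 0"
    using assms lim by (intro tendsto_neg_powr) auto
  ultimately show "(\<lambda>n. norm (pw s (x + real n))) \<longlonglongrightarrow> 0"
    by (rule Lim_transform_eventually[rotated])
qed

lemma pw_telescope:
  assumes "1 < Re w"
  shows "(\<lambda>n. pw (w - 1) (x + real n) - pw (w - 1) (x + real n + 1)) sums pw (w - 1) x"
proof -
  have "(\<lambda>n. pw (w - 1) (x + real n)) \<longlonglongrightarrow> 0"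
    using assms by (intro tendsto_pw_0) simp
  from telescope_sums'[OF this] show ?thesis
    by (simp add: add_ac)
qed

context
  fixes a :: real
  assumes a: "0 < a"
begin

lemma zeta_num_eq:
  assumes "1 < Re w"
  shows "summable (\<lambda>m. pw w (real m + a))"
    "zeta_num a w = (w - 1) * (\<Sum>m. pw w (real m + a))"
proof -
  have "summable (\<lambda>m. norm (pw w (real m + a)))"
  proof (rule summable_comparison_test'[where N = 1])
    show "summable (\<lambda>m. real m powr (- Re w))"
      using assms by (rule summable_powr_neg)
    show "norm (norm (pw w (real m + a))) \<le> real m powr (- Re w)" if "m \<ge> 1" for m
      using norm_pw_le[OF a, of "real m" "real m + a" "Re w" w] a assms that by simp
  qed
  then show sm: "summable (\<lambda>m. pw w (real m + a))" by (rule summable_norm_cancel)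
  have "(\<lambda>m. left_error w (real m + a)) sums ((w - 1) * (\<Sum>m. pw w (real m + a)) - pw (w - 1) a)"
    using sums_diff[OF sums_mult[OF summable_sums[OF sm], of "w - 1"] pw_telescope[OF assms, of a]]
    by (simp add: left_error_def add_ac)
  then show "zeta_num a w = (w - 1) * (\<Sum>m. pw w (real m + a))"
    by (simp add: zeta_num_def sums_iff)
qed

lemma gap_eq:
  assumes "1 < Re s"
  shows "gap a s m = pw (s - 1) (real m + a) - (s - 1) * tail_sum a 1 s m"
proof -
  have sm: "summable (\<lambda>n. pw s (real m + real (Suc n) + a))"
    using abel_summable_pw[OF a, of 1 s m] assms
    by (auto simp: abel_summable_def abscissa_def intro: summable_norm_cancel simp del: of_nat_Suc)
  define S where "S = (\<Sum>n. pw s (real m + real (Suc n) + a))"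
  have "real m + real (Suc n) + a = real m + a + real n + 1" for n by simp
  then have S: "(\<lambda>n. pw s (real m + a + real n + 1)) sums S"
    using summable_sums[OF sm, folded S_def] by (simp only:)
  have "(\<lambda>n. right_error s (real m + a + real n)) sums
      (pw (s - 1) (real m + a) - (s - 1) * S)"
    unfolding right_error_def by (intro sums_diff pw_telescope assms sums_mult S)
  then show ?thesis
    by (simp add: gap_def tail_sum_def abel_sum_def sums_iff S_def)
qed

text \<open>The terms of \<open>gap\<close> are \<open>O((m + n + a) powr (- 2))\<close> on \<open>Re s \<ge> 1\<close>.  The exponent is split
  unevenly: \<open>1 + \<delta>\<close> for the convergence in \<open>n\<close>, the rest for \<open>m\<close>, where the factor
  \<open>pw s1\<close> with \<open>Re s1 > \<delta>\<close> makes up for the loss.\<close>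

lemma norm_gap_le:
  assumes \<delta>: "0 < \<delta>" "\<delta> \<le> 1"
  obtains C where "0 \<le> C" "\<And>s m. 1 \<le> Re s \<Longrightarrow> norm s \<le> K \<Longrightarrow> 1 \<le> m \<Longrightarrow>
    norm (gap a s m) \<le> C * real m powr (- (1 - \<delta>))"
proof -
  have sm: "summable (\<lambda>n. real (Suc n) powr (- (1 + \<delta>)))"
    by (intro summable_powr_neg) (use \<delta> in auto)
  define C where "C = (\<bar>K\<bar> + 1) * \<bar>K\<bar> * (\<Sum>n. real (Suc n) powr (- (1 + \<delta>)))"
  show thesis
  proof (rule that)
    show "0 \<le> C" unfolding C_def by (intro mult_nonneg_nonneg suminf_nonneg sm) auto
    fix s m assume s: "1 \<le> Re s" "norm s \<le> K" and m: "1 \<le> (m::nat)"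
    define c where "c = (\<bar>K\<bar> + 1) * \<bar>K\<bar> * real m powr (- (1 - \<delta>))"
    have le: "norm (right_error s (real m + a + real n)) \<le> c * real (Suc n) powr (- (1 + \<delta>))" for n
    proof -
      define x where "x = real m + a + real n"
      have x: "real m \<le> x" "real (Suc n) \<le> x" "1 \<le> x" using a m by (auto simp: x_def)
      have "norm (right_error s x) \<le> (\<bar>K\<bar> + 1) * \<bar>K\<bar> * x powr (- (1 + 1))"
        using x s by (intro norm_right_error) auto
      also have "x powr (- (1 + 1)) = x powr (- (1 - \<delta>)) * x powr (- (1 + \<delta>))"
        by (simp add: powr_add[symmetric])
      also have "(\<bar>K\<bar> + 1) * \<bar>K\<bar> * \<dots> \<le>
          (\<bar>K\<bar> + 1) * \<bar>K\<bar> * (real m powr (- (1 - \<delta>)) * real (Suc n) powr (- (1 + \<delta>)))"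
        using x m \<delta> by (intro mult_left_mono mult_mono powr_neg_le) auto
      finally show ?thesis by (simp add: x_def c_def mult.assoc)
    qed
    have "norm (gap a s m) \<le> (\<Sum>n. c * real (Suc n) powr (- (1 + \<delta>)))"
      unfolding gap_def by (rule norm_suminf_le[OF le summable_mult[OF sm]])
    also have "\<dots> = C * real m powr (- (1 - \<delta>))"
      by (subst suminf_mult[OF sm]) (simp add: C_def c_def mult_ac)
    finally show "norm (gap a s m) \<le> C * real m powr (- (1 - \<delta>))" .
  qed
qed

lemma holomorphic2_on_exponent: "(\<lambda>p. fst p + snd p - c) holomorphic2_on U"
  by (intro holomorphic2_on_diff holomorphic2_on_add holomorphic2_on_fst holomorphic2_on_snd
      holomorphic2_on_const)

lemma holomorphic2_on_zeta_num:
  "(\<lambda>p. zeta_num a (fst p + snd p - 1)) holomorphic2_on half_spaces 0 1"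
  unfolding zeta_num_def
proof (intro holomorphic2_on_add holomorphic2_on_suminf open_half_spaces)
  show "(\<lambda>p. pw (fst p + snd p - 1 - 1) a) holomorphic2_on half_spaces 0 1"
    by (intro holomorphic2_on_pw a holomorphic2_on_diff holomorphic2_on_exponent holomorphic2_on_const)
  show "(\<lambda>p. left_error (fst p + snd p - 1) (real m + a)) holomorphic2_on half_spaces 0 1" for m
    unfolding left_error_def using a
    by (intro holomorphic2_on_pw holomorphic2_on_diff holomorphic2_on_mult holomorphic2_on_exponent
        holomorphic2_on_const) (auto simp: add_nonneg_pos)
  show "locally_dominated (\<lambda>m p. left_error (fst p + snd p - 1) (real m + a)) (half_spaces 0 1)"
  proof (rule locally_dominated_half_spacesI)
    fix \<delta>1 \<delta>2 K :: real assume \<delta>: "0 < \<delta>1" "1 < \<delta>2"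
    define L where "L = 2 * K + 1"
    have le: "norm (left_error (s1 + s2 - 1) (real m + a)) \<le> (L + 1) * L * real m powr (- (\<delta>1 + 1))"
      if "\<delta>1 \<le> Re s1" "\<delta>2 \<le> Re s2" "norm s1 \<le> K" "norm s2 \<le> K" "m \<ge> 1" for s1 s2 m
      using a that \<delta> norm_triangle_ineq[of s1 s2] norm_triangle_ineq4[of "s1 + s2" 1]
      by (intro norm_left_error) (auto simp: L_def)
    have "summable (\<lambda>m. (L + 1) * L * real m powr (- (\<delta>1 + 1)))"
      by (intro summable_mult summable_powr_neg) (use \<delta> in auto)
    then show "\<exists>M. summable M \<and> (\<forall>s1 s2. \<delta>1 \<le> Re s1 \<longrightarrow> \<delta>2 \<le> Re s2 \<longrightarrow> norm s1 \<le> K \<longrightarrow>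
        norm s2 \<le> K \<longrightarrow> (\<forall>m\<ge>1. norm (left_error (fst (s1, s2) + snd (s1, s2) - 1) (real m + a)) \<le> M m))"
      using le by (intro exI[of _ "\<lambda>m. (L + 1) * L * real m powr (- (\<delta>1 + 1))"]) simp
  qed
qed

lemma holomorphic2_on_gap: "(\<lambda>p. gap a (snd p) m) holomorphic2_on half_spaces 0 1"
  unfolding gap_def
proof (intro holomorphic2_on_suminf open_half_spaces)
  show "(\<lambda>p. right_error (snd p) (real m + a + real n)) holomorphic2_on half_spaces 0 1" for n
    unfolding right_error_def using a
    by (intro holomorphic2_on_pw holomorphic2_on_diff holomorphic2_on_mult holomorphic2_on_snd
        holomorphic2_on_const) (auto simp: add_nonneg_pos add_pos_nonneg)
  show "locally_dominated (\<lambda>n p. right_error (snd p) (real m + a + real n)) (half_spaces 0 1)"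
  proof (rule locally_dominated_half_spacesI)
    fix \<delta>1 \<delta>2 K :: real assume \<delta>: "0 < \<delta>1" "1 < \<delta>2"
    have le: "norm (right_error s2 (real m + a + real n)) \<le> (K + 1) * K * real n powr (- (1 + 1))"
      if "\<delta>2 \<le> Re s2" "norm s2 \<le> K" "n \<ge> 1" for s2 n
      using a that \<delta> by (intro norm_right_error) auto
    have "summable (\<lambda>n. (K + 1) * K * real n powr (- (1 + 1)))"
      by (intro summable_mult summable_powr_neg) auto
    then show "\<exists>M. summable M \<and> (\<forall>s1 s2. \<delta>1 \<le> Re s1 \<longrightarrow> \<delta>2 \<le> Re s2 \<longrightarrow> norm s1 \<le> K \<longrightarrow>
        norm s2 \<le> K \<longrightarrow> (\<forall>n\<ge>1. norm (right_error (snd (s1, s2)) (real m + a + real n)) \<le> M n))"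
      using le by (intro exI[of _ "\<lambda>n. (K + 1) * K * real n powr (- (1 + 1))"]) simp
  qed
qed

lemma locally_dominated_gap_sum:
  "locally_dominated (\<lambda>m p. pw (fst p) (real m + a) * gap a (snd p) m) (half_spaces 0 1)"
proof (rule locally_dominated_half_spacesI)
  fix \<delta>1 \<delta>2 K :: real assume \<delta>12: "0 < \<delta>1" "1 < \<delta>2"
  \<comment> \<open>Total exponent of \<open>m\<close>: \<open>\<delta>\<close> from the power and \<open>1 - \<delta> / 2\<close> from \<open>gap\<close>, which exceeds \<open>1\<close>.\<close>
  define \<delta> where "\<delta> = min \<delta>1 1"
  have \<delta>: "0 < \<delta>" "\<delta> \<le> 1" "\<delta> \<le> \<delta>1" using \<delta>12 by (auto simp: \<delta>_def)
  have \<delta>2: "0 < \<delta> / 2" "\<delta> / 2 \<le> 1" using \<delta> by auto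
  obtain C where C: "0 \<le> C" "\<And>s m. 1 \<le> Re s \<Longrightarrow> norm s \<le> K \<Longrightarrow> 1 \<le> m \<Longrightarrow>
      norm (gap a s m) \<le> C * real m powr (- (1 - \<delta> / 2))"
    using norm_gap_le[OF \<delta>2, where K = K] by blast
  have le: "norm (pw s1 (real m + a) * gap a s2 m) \<le> C * real m powr (- (1 + \<delta> / 2))"
    if s: "\<delta>1 \<le> Re s1" "\<delta>2 \<le> Re s2" "norm s2 \<le> K" and m: "m \<ge> 1" for s1 s2 m
  proof -
    have "norm (pw s1 (real m + a) * gap a s2 m) \<le>
        real m powr (- \<delta>) * (C * real m powr (- (1 - \<delta> / 2)))"
      unfolding norm_mult using s m \<delta> \<delta>12 C a by (intro mult_mono norm_pw_le[OF a]) auto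
    also have "\<dots> = C * (real m powr (- \<delta>) * real m powr (- (1 - \<delta> / 2)))" by simp
    also have "real m powr (- \<delta>) * real m powr (- (1 - \<delta> / 2)) = real m powr (- (1 + \<delta> / 2))"
      unfolding powr_add[symmetric]
      by (rule arg_cong[where f = "\<lambda>e. real m powr e"]) (simp add: field_simps)
    finally show ?thesis .
  qed
  have "summable (\<lambda>m. C * real m powr (- (1 + \<delta> / 2)))"
    by (intro summable_mult summable_powr_neg) (use \<delta> in auto)
  then show "\<exists>M. summable M \<and> (\<forall>s1 s2. \<delta>1 \<le> Re s1 \<longrightarrow> \<delta>2 \<le> Re s2 \<longrightarrow> norm s1 \<le> K \<longrightarrow>
      norm s2 \<le> K \<longrightarrow> (\<forall>m\<ge>1. norm (pw (fst (s1, s2)) (real m + a) * gap a (snd (s1, s2)) m) \<le> M m))"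
    using le by (intro exI[of _ "\<lambda>m. C * real m powr (- (1 + \<delta> / 2))"]) simp
qed

lemma holomorphic2_on_double_zeta_num: "double_zeta_num a holomorphic2_on half_spaces 0 1"
proof -
  have "gap_sum a holomorphic2_on half_spaces 0 1"
    unfolding gap_sum_def using a
    by (intro holomorphic2_on_suminf open_half_spaces locally_dominated_gap_sum holomorphic2_on_mult
        holomorphic2_on_gap holomorphic2_on_pw holomorphic2_on_fst) (auto simp: add_nonneg_pos)
  then show ?thesis
    unfolding double_zeta_num_def
    by (intro holomorphic2_on_diff holomorphic2_on_mult holomorphic2_on_zeta_num
        holomorphic2_on_exponent)
qed

lemma holomorphic2_on_denominator: "(\<lambda>p. (fst p + snd p - 2) * (snd p - 1)) holomorphic2_on U"
  by (intro holomorphic2_on_mult holomorphic2_on_exponent holomorphic2_on_diff holomorphic2_on_snd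
      holomorphic2_on_const)

text \<open>On \<open>half_spaces 0 1\<close> the denominator vanishes only on the line \<open>s1 + s2 = 2\<close>, which has no interior
  points.\<close>

lemma double_zeta_meromorphic: "double_zeta a meromorphic2_on half_spaces 0 1"
  unfolding meromorphic2_on_def
proof
  let ?U = "half_spaces 0 1" and ?h = "\<lambda>p::complex \<times> complex. (fst p + snd p - 2) * (snd p - 1)"
  fix p assume p: "p \<in> ?U"
  have "?U \<subseteq> closure {q \<in> ?U. ?h q \<noteq> 0}"
  proof (intro subsetI, unfold closure_approachable, intro allI impI)
    fix q :: "complex \<times> complex" and e :: real assume q: "q \<in> ?U" and e: "0 < e"
    define t where "t = (if fst q + snd q = 2 then e / 2 else 0)"
    define q' where "q' = (fst q + of_real t, snd q)"
    have "q' \<in> ?U" using q e by (auto simp: q'_def half_spaces_def t_def)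
    moreover have "fst q' + snd q' \<noteq> 2"
      using e by (auto simp: q'_def t_def complex_eq_iff)
    moreover have "snd q' \<noteq> 1" using q by (auto simp: q'_def half_spaces_def)
    moreover have "dist q' q < e"
      using e by (simp add: q'_def t_def dist_prod_def dist_norm)
    ultimately show "\<exists>y\<in>{q \<in> ?U. ?h q \<noteq> 0}. dist y q < e"
      by (intro bexI[of _ q']) simp_all
  qed
  then show "\<exists>V g h. open V \<and> p \<in> V \<and> g holomorphic2_on V \<and> h holomorphic2_on V \<and>
      V \<subseteq> closure {q \<in> V. h q \<noteq> 0} \<and> (\<forall>q\<in>V. h q \<noteq> 0 \<longrightarrow> double_zeta a q = g q / h q)"
    using p open_half_spaces holomorphic2_on_double_zeta_num holomorphic2_on_denominator
    by (intro exI[of _ ?U] exI[of _ "double_zeta_num a"] exI[of _ ?h]) (simp add: double_zeta_def)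
qed

lemma double_zeta_eq_series:
  assumes s: "1 < Re s1" "1 < Re s2"
  shows "double_zeta a (s1, s2) = Phi2_series s1 s2 a 1 1"
proof -
  define w where "w = s1 + s2 - 1"
  have w: "1 < Re w" using s by (simp add: w_def)
  note zn = zeta_num_eq[OF w]
  define P where "P = (\<Sum>m. pw s1 (real m + a) * tail_sum a 1 s2 m)"
  define S where "S = (\<Sum>m. pw w (real m + a))"
  have sm: "summable (\<lambda>m. pw s1 (real m + a) * tail_sum a 1 s2 m)"
    using summable_pw_tail_sum[OF a, of 1 s1 s2] s by (auto simp: abscissa_def intro: summable_norm_cancel)
  have "Phi2_series s1 s2 a 1 1 = P"
    unfolding P_def using double_sum_eq_series[OF a, of 1 1 s1 s2] s by (simp add: double_sum_def abel_sum_def)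
  moreover have gs: "gap_sum a (s1, s2) = S - (s2 - 1) * P"
  proof -
    have "pw s1 (real m + a) * gap a s2 m =
        pw w (real m + a) - (s2 - 1) * (pw s1 (real m + a) * tail_sum a 1 s2 m)" for m
    proof -
      have "pw s1 (real m + a) * pw (s2 - 1) (real m + a) = pw w (real m + a)"
        by (simp add: pw_add[symmetric] w_def algebra_simps)
      then show ?thesis by (simp add: gap_eq[OF s(2)] algebra_simps)
    qed
    then show ?thesis
      unfolding S_def P_def
      using zn(1) sm by (simp add: gap_sum_def suminf_diff[symmetric] suminf_mult[symmetric] summable_mult)
  qed
  moreover have "double_zeta_num a (s1, s2) = zeta_num a w - (w - 1) * gap_sum a (s1, s2)"
    by (simp add: double_zeta_num_def w_def)
  then have "double_zeta_num a (s1, s2) = (w - 1) * (s2 - 1) * P"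
    unfolding zn(2)[folded S_def] gs by (simp add: algebra_simps)
  ultimately have "double_zeta_num a (s1, s2) = (w - 1) * (s2 - 1) * Phi2_series s1 s2 a 1 1"
    by simp
  moreover have "w - 1 \<noteq> 0" "s2 - 1 \<noteq> 0" using w s by auto
  ultimately show ?thesis by (simp add: double_zeta_def w_def)
qed

lemma Phi2_eq_double_zeta:
  assumes s: "0 < Re s1" "1 < Re s2" "s1 + s2 \<noteq> 2"
  shows "Phi2 s1 s2 a 1 1 = double_zeta a (s1, s2)"
proof (rule Phi2_eqI)
  let ?U = "half_spaces 0 1"
  define W where "W = {p \<in> ?U. fst p + snd p - 2 \<noteq> 0}"
  show "open ?U" "convex ?U" by (rule open_half_spaces, rule convex_half_spaces)
  show "Phi2_conv \<subseteq> ?U" by (auto simp: Phi2_conv_def half_spaces_def)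
  show "double_zeta a meromorphic2_on ?U" by (rule double_zeta_meromorphic)
  show "double_zeta a (w1, w2) = Phi2_series w1 w2 a 1 1" if "(w1, w2) \<in> Phi2_conv" for w1 w2
    using that by (intro double_zeta_eq_series) (auto simp: Phi2_conv_def)
  show "open W"
    unfolding W_def
    by (rule open_nonzero[OF open_half_spaces holomorphic2_on_imp_continuous_on])
      (rule holomorphic2_on_exponent)
  show WU: "W \<subseteq> ?U" by (auto simp: W_def)
  show "(s1, s2) \<in> W" using s by (auto simp: W_def half_spaces_def)
  have "(\<lambda>p. double_zeta_num a p * inverse ((fst p + snd p - 2) * (snd p - 1))) holomorphic2_on W"
  proof (intro holomorphic2_on_mult holomorphic2_on_compose[OF holomorphic2_on_denominator])
    show "double_zeta_num a holomorphic2_on W"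
      using holomorphic2_on_double_zeta_num WU by (rule holomorphic2_on_subset)
    show "inverse holomorphic_on (- {0::complex})" by (auto intro!: holomorphic_intros)
    show "(\<lambda>p. (fst p + snd p - 2) * (snd p - 1)) ` W \<subseteq> - {0}"
      by (auto simp: W_def half_spaces_def)
  qed auto
  then show "double_zeta a holomorphic2_on W"
    unfolding double_zeta_def divide_inverse .
qed

end

section \<open>Inequalities for real powers\<close>

lemma powr_has_derivative:
  assumes "0 < (x::real)"
  shows "((\<lambda>x. x powr p) has_real_derivative p * x powr (p - 1)) (at x)"
  using assms by (rule has_real_derivative_powr)

text \<open>The midpoint rule underestimates the integral of the convex function \<open>t powr (p - 1)\<close> over
  \<open>[x - 1/2, x + 1/2]\<close>.  The derivative in the half-width \<open>h\<close> of the interval is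
  nonnegative by the inequality of arithmetic and geometric means for
  \<open>(x + h) powr (p - 1)\<close> and \<open>(x - h) powr (p - 1)\<close>.\<close>

lemma powr_midpoint:
  fixes x p :: real
  assumes x: "1 / 2 \<le> x" and p: "0 < p" "p < 1"
  shows "p * x powr (p - 1) \<le> (x + 1 / 2) powr p - (x - 1 / 2) powr p"
proof -
  define f where "f h = (x + h) powr p - (x - h) powr p - 2 * h * (p * x powr (p - 1))" for h
  have "f 0 \<le> f (1 / 2)"
  proof (rule DERIV_nonneg_imp_increasing_open[where f = f])
    show "continuous_on {0..1 / 2} f"
      unfolding f_def using x p by (intro continuous_intros continuous_on_powr') auto
    fix h :: real assume h: "0 < h" "h < 1 / 2"
    have xh: "0 < x" "0 < x + h" "0 < x - h" using x h by auto
    have d: "(f has_real_derivative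
        p * (x + h) powr (p - 1) + p * (x - h) powr (p - 1) - 2 * (p * x powr (p - 1))) (at h)"
      unfolding f_def using xh by (auto intro!: derivative_eq_intros)
    \<comment> \<open>The geometric mean of \<open>(x + h) powr (p - 1)\<close> and \<open>(x - h) powr (p - 1)\<close> is a power of \<open>x\<^sup>2 - h\<^sup>2 < x\<^sup>2\<close> with negative exponent.\<close>
    define q where "q = (p - 1) / 2"
    have q: "p - 1 = q + q" "q \<le> 0" using p by (auto simp: q_def)
    let ?A = "(x + h) powr q" and ?B = "(x - h) powr q"
    have hh: "h * h < x * x" using xh h by (intro mult_strict_mono) auto
    have "x powr q * x powr q = (x * x) powr q" using xh by (simp add: powr_mult)
    also have "\<dots> \<le> ((x + h) * (x - h)) powr q"
      using xh q hh by (intro powr_mono2') (auto simp: algebra_simps)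
    also have "\<dots> = ?A * ?B" using xh by (simp add: powr_mult)
    finally have "2 * (x powr q * x powr q) \<le> ?A * ?A + ?B * ?B"
      using sum_squares_bound[of ?A ?B] by (simp add: power2_eq_square)
    then have "0 \<le> p * (?A * ?A + ?B * ?B - 2 * (x powr q * x powr q))"
      using p by simp
    then have "0 \<le> p * (x + h) powr (p - 1) + p * (x - h) powr (p - 1) - 2 * (p * x powr (p - 1))"
      unfolding q(1) powr_add by (simp add: algebra_simps)
    then show "\<exists>y. (f has_real_derivative y) (at h) \<and> 0 \<le> y" using d by blast
  qed simp
  then show ?thesis by (simp add: f_def)
qed

text \<open>The trapezoidal rule overestimates the same integral, here over \<open>[x, x + 1]\<close>.  The derivative in
  the length \<open>h\<close> is nonnegative because a convex function lies above its tangent at \<open>x + h\<close>.\<close>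

lemma powr_trapezoid:
  fixes x p :: real
  assumes x: "0 < x" and p: "0 < p" "p < 1"
  shows "(x + 1) powr p - x powr p \<le> p / 2 * (x powr (p - 1) + (x + 1) powr (p - 1))"
proof -
  define f where "f h = p / 2 * h * (x powr (p - 1) + (x + h) powr (p - 1)) - (x + h) powr p" for h
  have "f 0 \<le> f 1"
  proof (rule DERIV_nonneg_imp_nondecreasing[where f = f])
    fix h :: real assume h: "0 \<le> h"
    have xh: "0 < x + h" using x h by simp
    define D where "D = p / 2 * (x powr (p - 1) + (x + h) powr (p - 1)) +
        p / 2 * h * ((p - 1) * (x + h) powr (p - 2)) - p * (x + h) powr (p - 1)"
    have d: "(f has_real_derivative D) (at h)"
      unfolding f_def D_def using xh
      by (auto intro!: derivative_eq_intros simp: field_simps)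
    have "(1 - p) * h * (x + h) powr (p - 2) \<le> x powr (p - 1) - (x + h) powr (p - 1)"
    proof (cases "h = 0")
      case False
      then have "x < x + h" using h by simp
      have "\<exists>\<xi>. x < \<xi> \<and> \<xi> < x + h \<and> (x + h) powr (p - 1) - x powr (p - 1) =
          (x + h - x) * ((p - 1) * \<xi> powr (p - 1 - 1))"
        using x \<open>x < x + h\<close> by (intro MVT2 powr_has_derivative) auto
      then obtain \<xi> where \<xi>: "x < \<xi>" "\<xi> < x + h" "(x + h) powr (p - 1) - x powr (p - 1) =
          h * ((p - 1) * \<xi> powr (p - 2))"
        by (auto simp: algebra_simps)
      have "(x + h) powr (p - 2) \<le> \<xi> powr (p - 2)"
        using \<xi> x p by (intro powr_mono2') auto
      then have "(1 - p) * h * (x + h) powr (p - 2) \<le> (1 - p) * h * \<xi> powr (p - 2)"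
        using p h by (intro mult_left_mono) auto
      then show ?thesis using \<xi>(3) by (simp add: algebra_simps)
    qed simp
    then have "0 \<le> p / 2 * (x powr (p - 1) - (x + h) powr (p - 1) - (1 - p) * h * (x + h) powr (p - 2))"
      using p by simp
    also have "\<dots> = D" by (simp add: D_def field_simps)
    finally show "\<exists>y. (f has_real_derivative y) (at h) \<and> 0 \<le> y" using d by blast
  qed simp
  then show ?thesis by (simp add: f_def)
qed

lemma powr_increment_bounds:
  fixes x p :: real
  assumes x: "0 < x" and p: "p < 1" "p \<noteq> 0"
  shows "(x + 1) powr (p - 1) < ((x + 1) powr p - x powr p) / p"
    "((x + 1) powr p - x powr p) / p < x powr (p - 1)"
proof -
  have "\<exists>\<xi>. x < \<xi> \<and> \<xi> < x + 1 \<and> (x + 1) powr p - x powr p = (x + 1 - x) * (p * \<xi> powr (p - 1))"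
    using x by (intro MVT2 powr_has_derivative) auto
  then obtain \<xi> where \<xi>: "x < \<xi>" "\<xi> < x + 1" "(x + 1) powr p - x powr p = p * \<xi> powr (p - 1)"
    by auto
  have "(x + 1) powr (p - 1) < \<xi> powr (p - 1)" "\<xi> powr (p - 1) < x powr (p - 1)"
    using \<xi> x p by (auto intro!: powr_less_mono2_neg)
  then show "(x + 1) powr (p - 1) < ((x + 1) powr p - x powr p) / p"
    "((x + 1) powr p - x powr p) / p < x powr (p - 1)"
    using \<xi>(3) p(2) by auto
qed

section \<open>Real zeros of the double zeta function\<close>

lemma left_error_of_real:
  assumes "0 < x"
  shows "left_error (of_real u) x =
    of_real ((x + 1) powr (1 - u) - x powr (1 - u) - (1 - u) * x powr (- u))"
proof -
  have "of_real u - (1::complex) = of_real (u - 1)" by simp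
  then show ?thesis
    unfolding left_error_def using assms by (simp only: pw_of_real) (simp add: pw_of_real algebra_simps)
qed

lemma right_error_of_real:
  assumes "0 < x"
  shows "right_error (of_real s) x =
    of_real (x powr (1 - s) - (x + 1) powr (1 - s) - (s - 1) * (x + 1) powr (- s))"
proof -
  have "of_real s - (1::complex) = of_real (s - 1)" by simp
  then show ?thesis
    unfolding right_error_def using assms by (simp only: pw_of_real) (simp add: pw_of_real algebra_simps)
qed

context
  fixes a :: real
  assumes a: "0 < a"
begin

text \<open>The explicit partial sums let each estimate of \<open>\<zeta>(u, a)\<close> be proved by induction over \<open>N\<close> from a
  one-step inequality.  Since \<open>u - 1 < 0\<close>, the sign of \<open>zeta_num a u\<close> is opposite to that of
  \<open>\<zeta>(u, a)\<close>.\<close>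

lemma zeta_num_real:
  assumes u: "0 < u"
  obtains Z where "zeta_num a (of_real u) = of_real Z"
    "(\<lambda>N. a powr (1 - u) + (\<Sum>m<N. (real m + a + 1) powr (1 - u) - (real m + a) powr (1 - u)
        - (1 - u) * (real m + a) powr (- u))) \<longlonglongrightarrow> Z"
proof -
  let ?t = "\<lambda>m. (real m + a + 1) powr (1 - u) - (real m + a) powr (1 - u) - (1 - u) * (real m + a) powr (- u)"
  have t: "left_error (of_real u) (real m + a) = of_real (?t m)" for m
    using a by (intro left_error_of_real) (auto simp: add_nonneg_pos)
  have "summable (\<lambda>m. norm (left_error (of_real u) (real m + a)))"
  proof (rule summable_comparison_test'[where N = 1])
    show "summable (\<lambda>m. (\<bar>u\<bar> + 1) * \<bar>u\<bar> * real m powr (- (u + 1)))"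
      by (intro summable_mult summable_powr_neg) (use u in auto)
    show "norm (norm (left_error (of_real u) (real m + a))) \<le> (\<bar>u\<bar> + 1) * \<bar>u\<bar> * real m powr (- (u + 1))"
      if "m \<ge> 1" for m
      unfolding real_norm_def abs_norm_cancel
      by (rule norm_left_error) (use a u that in auto)
  qed
  then have "summable ?t"
    by (simp only: t norm_of_real summable_rabs_cancel)
  then have s: "?t sums (\<Sum>m. ?t m)" by (rule summable_sums)
  have "of_real u - 1 = complex_of_real (u - 1)" by simp
  then have "pw (of_real u - 1) a = of_real (a powr (1 - u))"
    using a by (simp only: pw_of_real) simp
  moreover have "(\<Sum>m. left_error (of_real u) (real m + a)) = of_real (\<Sum>m. ?t m)"
    unfolding t using sums_of_real[OF s] by (rule sums_unique[symmetric])
  ultimately have "zeta_num a (of_real u) = of_real (a powr (1 - u) + (\<Sum>m. ?t m))"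
    by (simp add: zeta_num_def)
  then show thesis
    using that tendsto_add[OF tendsto_const s[unfolded sums_def]] by blast
qed

text \<open>The midpoint rule bounds the partial sums below by
  \<open>(N + a) powr (1 - u) - (N + a - 1/2) powr (1 - u) \<ge> 0\<close>.  At the start of the induction the
  difference of the two sides is \<open>(a - 1/2) powr (1 - u)\<close>, and \<open>a \<ge> 1/2\<close> keeps the interval around
  \<open>a\<close> inside the positive axis.\<close>

lemma zeta_num_nonneg_of_half_le:
  assumes u: "0 < u" "u < 1" and a2: "1 / 2 \<le> a"
  shows "0 \<le> Re (zeta_num a (of_real u))"
proof -
  let ?S = "\<lambda>N. a powr (1 - u) + (\<Sum>m<N. (real m + a + 1) powr (1 - u) - (real m + a) powr (1 - u)
        - (1 - u) * (real m + a) powr (- u))"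
  obtain Z where Z: "zeta_num a (of_real u) = of_real Z" "?S \<longlonglongrightarrow> Z"
    using zeta_num_real[OF u(1)] by blast
  have "(real N + a) powr (1 - u) - (real N + a - 1 / 2) powr (1 - u) \<le> ?S N" for N
  proof (induction N)
    case (Suc N)
    show ?case
      using Suc powr_midpoint[of "real N + a" "1 - u"] u a2 by (simp add: add_ac)
  qed simp
  moreover have "0 \<le> (real N + a) powr (1 - u) - (real N + a - 1 / 2) powr (1 - u)" for N
    using u a2 by (simp add: powr_mono2)
  ultimately have "0 \<le> ?S N" for N by (meson order_trans)
  then have "0 \<le> Z" by (intro LIMSEQ_le_const[OF Z(2)]) auto
  then show ?thesis by (simp add: Z(1))
qed

text \<open>The trapezoidal rule bounds \<open>(u - 1) \<zeta>(u, a)\<close> above by \<open>a powr (- u) * (a - (1 - u) / 2)\<close>.  As \<open>u\<close> tends to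
  \<open>0\<close>, this shows the sign of \<open>\<zeta>(0, a) = 1/2 - a\<close>.\<close>

lemma zeta_num_neg:
  assumes u: "0 < u" "u < 1" and a2: "2 * a < 1 - u"
  shows "Re (zeta_num a (of_real u)) < 0"
proof -
  define p where "p = 1 - u"
  have p: "0 < p" "p < 1" "- u = p - 1" "1 - u = p" using u by (auto simp: p_def)
  let ?S = "\<lambda>N. a powr p + (\<Sum>m<N. (real m + a + 1) powr p - (real m + a) powr p
        - p * (real m + a) powr (p - 1))"
  obtain Z where Z: "zeta_num a (of_real u) = of_real Z" "?S \<longlonglongrightarrow> Z"
    using zeta_num_real[OF u(1)] unfolding p(3,4) by blast
  have part: "?S N \<le> a powr p - p / 2 * a powr (p - 1) + p / 2 * (real N + a) powr (p - 1)" for N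
  proof (induction N)
    case (Suc N)
    have "(real N + a + 1) powr p - (real N + a) powr p - p * (real N + a) powr (p - 1)
        \<le> p / 2 * (real (Suc N) + a) powr (p - 1) - p / 2 * (real N + a) powr (p - 1)"
      using powr_trapezoid[of "real N + a" p] a p by (simp add: algebra_simps)
    then show ?case using Suc by simp
  qed simp
  have "(\<lambda>N. (a + real N) powr (p - 1)) \<longlonglongrightarrow> 0"
    using p by (intro tendsto_neg_powr filterlim_tendsto_add_at_top[OF tendsto_const]
        filterlim_real_sequentially) auto
  then have "(\<lambda>N. (real N + a) powr (p - 1)) \<longlonglongrightarrow> 0"
    by (simp only: add.commute)
  then have "(\<lambda>N. a powr p - p / 2 * a powr (p - 1) + p / 2 * (real N + a) powr (p - 1))
      \<longlonglongrightarrow> a powr p - p / 2 * a powr (p - 1) + p / 2 * 0"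
    by (intro tendsto_intros)
  from LIMSEQ_le[OF Z(2) this] part
  have "Z \<le> a powr p - p / 2 * a powr (p - 1)" by auto
  also have "\<dots> = a powr (p - 1) * (a - p / 2)"
    using a by (simp add: powr_diff field_simps)
  also have "\<dots> < 0" using a a2 by (simp add: mult_less_0_iff p_def)
  finally show ?thesis by (simp add: Z(1))
qed

text \<open>Values at right endpoints bound \<open>(u - 1) \<zeta>(u, a)\<close> below by \<open>a powr (- u) * (a - (1 - u))\<close>.\<close>

lemma zeta_num_nonneg_of_le:
  assumes u: "0 < u" "u < 1" and a2: "1 - u \<le> a"
  shows "0 \<le> Re (zeta_num a (of_real u))"
proof -
  define p where "p = 1 - u"
  have p: "0 < p" "p < 1" "- u = p - 1" "1 - u = p" using u by (auto simp: p_def)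
  let ?S = "\<lambda>N. a powr p + (\<Sum>m<N. (real m + a + 1) powr p - (real m + a) powr p
        - p * (real m + a) powr (p - 1))"
  obtain Z where Z: "zeta_num a (of_real u) = of_real Z" "?S \<longlonglongrightarrow> Z"
    using zeta_num_real[OF u(1)] unfolding p(3,4) by blast
  have part: "a powr p - p * a powr (p - 1) + p * (real N + a) powr (p - 1) \<le> ?S N" for N
  proof (induction N)
    case (Suc N)
    have "(real N + a + 1) powr (p - 1) < ((real N + a + 1) powr p - (real N + a) powr p) / p"
      using a p by (intro powr_increment_bounds) auto
    then have "p * (real (Suc N) + a) powr (p - 1) \<le> (real N + a + 1) powr p - (real N + a) powr p"
      using p by (simp add: field_simps)
    then show ?case using Suc by simp
  qed simp
  have "0 \<le> a powr (p - 1) * (a - p)" using a2 by (simp add: p_def)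
  also have "\<dots> = a powr p - p * a powr (p - 1)"
    using a by (simp add: powr_diff field_simps)
  finally have "0 \<le> a powr p - p * a powr (p - 1)" .
  then have "0 \<le> a powr p - p * a powr (p - 1) + p * (real N + a) powr (p - 1)" for N
    using p by simp
  with part have "0 \<le> ?S N" for N by (meson order_trans)
  then have "0 \<le> Z" by (intro LIMSEQ_le_const[OF Z(2)]) auto
  then show ?thesis by (simp add: Z(1))
qed

text \<open>On a decreasing function the right endpoint rule is too small, by at most the rule for left
  endpoints minus the one for right endpoints, and these differences telescope.\<close>

lemma gap_real:
  assumes s: "1 < s"
  obtains G where "gap a (of_real s) m = of_real G" "0 < G" "G \<le> (s - 1) * (real m + a) powr (- s)"
proof -
  define x where "x n = real m + a + real n" for n
  have x: "0 < x n" "x (Suc n) = x n + 1" "x 0 = real m + a" for n using a by (auto simp: x_def)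
  define t where "t n = x n powr (1 - s) - (x n + 1) powr (1 - s) - (s - 1) * (x n + 1) powr (- s)" for n
  have err: "right_error (of_real s) (x n) = of_real (t n)" for n
    unfolding t_def using x by (intro right_error_of_real)
  have inc: "(x n + 1) powr (1 - s - 1) < ((x n + 1) powr (1 - s) - x n powr (1 - s)) / (1 - s)"
    "((x n + 1) powr (1 - s) - x n powr (1 - s)) / (1 - s) < x n powr (1 - s - 1)" for n
    using x s by (intro powr_increment_bounds; simp)+
  have neg: "((x n + 1) powr (1 - s) - x n powr (1 - s)) / (1 - s) =
      (x n powr (1 - s) - (x n + 1) powr (1 - s)) / (s - 1)" for n
    using s by (simp add: field_simps)
  have t0: "0 < t n" for n
    using inc(1)[of n] s unfolding neg t_def by (simp add: field_simps)
  have t1: "t n \<le> (s - 1) * (x n powr (- s) - x (Suc n) powr (- s))" for n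
    using inc(2)[of n] s unfolding neg t_def x(2) by (simp add: field_simps)
  have "(\<lambda>n. x n powr (- s)) \<longlonglongrightarrow> 0"
    unfolding x_def using s
    by (intro tendsto_neg_powr filterlim_tendsto_add_at_top[OF tendsto_const] filterlim_real_sequentially) auto
  from sums_mult[OF telescope_sums'[OF this], of "s - 1"]
  have tele: "(\<lambda>n. (s - 1) * (x n powr (- s) - x (Suc n) powr (- s))) sums ((s - 1) * (real m + a) powr (- s))"
    by (simp add: x(3))
  have sm: "summable t"
    by (rule summable_comparison_test'[OF sums_summable[OF tele], of 0])
      (use t0 t1 in \<open>simp add: less_imp_le\<close>)
  have "gap a (of_real s) m = of_real (\<Sum>n. t n)"
    unfolding gap_def x_def[symmetric] err by (rule suminf_of_real[OF sm, symmetric])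
  moreover have "0 < (\<Sum>n. t n)" by (rule suminf_pos[OF sm]) (use t0 in blast)
  moreover have "(\<Sum>n. t n) \<le> (s - 1) * (real m + a) powr (- s)"
    using suminf_le[OF t1 sm sums_summable[OF tele]] tele by (simp add: sums_iff)
  ultimately show thesis by (rule that)
qed

lemma gap_sum_real:
  assumes s: "0 < s1" "1 < s2"
  obtains S where "gap_sum a (of_real s1, of_real s2) = of_real S" "0 < S"
    "S \<le> (s2 - 1) * (\<Sum>m. (real m + a) powr (- (s1 + s2)))"
proof -
  have "\<forall>m. \<exists>G. gap a (of_real s2) m = of_real G \<and> 0 < G \<and> G \<le> (s2 - 1) * (real m + a) powr (- s2)"
    using gap_real[OF s(2)] by metis
  then obtain G where G: "\<And>m. gap a (of_real s2) m = of_real (G m)" "\<And>m. 0 < G m"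
      "\<And>m. G m \<le> (s2 - 1) * (real m + a) powr (- s2)"
    by metis
  define t where "t m = (real m + a) powr (- s1) * G m" for m
  have ma: "0 < real m + a" for m using a by simp
  have term_eq: "pw (of_real s1) (real m + a) * gap a (of_real s2) m = of_real (t m)" for m
    using ma[of m] by (simp add: t_def G(1) pw_of_real)
  have t0: "0 < t m" for m using ma[of m] G(2)[of m] by (simp add: t_def)
  have t1: "t m \<le> (s2 - 1) * (real m + a) powr (- (s1 + s2))" for m
  proof -
    have "t m \<le> (real m + a) powr (- s1) * ((s2 - 1) * (real m + a) powr (- s2))"
      unfolding t_def by (intro mult_left_mono G) auto
    also have "\<dots> = (s2 - 1) * (real m + a) powr (- (s1 + s2))"
      by (simp add: powr_add[symmetric])
    finally show ?thesis .
  qed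
  have sm: "summable (\<lambda>m. (real m + a) powr (- (s1 + s2)))"
    using summable_pdiff[of a "s1 + s2" 0] a s by (simp add: add.commute)
  have smt: "summable t"
    by (rule summable_comparison_test'[OF summable_mult[OF sm, of "s2 - 1"], of 0])
      (use t0 t1 in \<open>simp add: less_imp_le\<close>)
  have "gap_sum a (of_real s1, of_real s2) = of_real (\<Sum>m. t m)"
    unfolding gap_sum_def fst_conv snd_conv term_eq by (rule suminf_of_real[OF smt, symmetric])
  moreover have "0 < (\<Sum>m. t m)" by (rule suminf_pos[OF smt]) (use t0 in blast)
  moreover have "(\<Sum>m. t m) \<le> (s2 - 1) * (\<Sum>m. (real m + a) powr (- (s1 + s2)))"
    using suminf_le[OF t1 smt summable_mult[OF sm]] suminf_mult[OF sm] by simp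
  ultimately show thesis by (rule that)
qed

lemma double_zeta_num_real:
  assumes s: "0 < s1" "1 < s2"
  obtains S where "double_zeta_num a (of_real s1, of_real s2) =
      of_real (Re (zeta_num a (of_real (s1 + s2 - 1))) + (2 - s1 - s2) * S)" "0 < S"
    "S \<le> (s2 - 1) * (\<Sum>m. (real m + a) powr (- (s1 + s2)))"
proof -
  obtain S where S: "gap_sum a (of_real s1, of_real s2) = of_real S" "0 < S"
      "S \<le> (s2 - 1) * (\<Sum>m. (real m + a) powr (- (s1 + s2)))"
    using gap_sum_real[OF s] by blast
  have "0 < s1 + s2 - 1" using s by simp
  then obtain Z where "zeta_num a (of_real (s1 + s2 - 1)) = of_real Z"
    using zeta_num_real by blast
  then have Z: "zeta_num a (of_real s1 + of_real s2 - 1) = of_real (Re (zeta_num a (of_real (s1 + s2 - 1))))"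
    by simp
  have "double_zeta_num a (of_real s1, of_real s2) =
      of_real (Re (zeta_num a (of_real (s1 + s2 - 1))) + (2 - s1 - s2) * S)"
    unfolding double_zeta_num_def fst_conv snd_conv S(1) Z by (simp add: algebra_simps)
  then show thesis using S(2,3) by (rule that)
qed

text \<open>Both summands of the numerator are nonnegative, and the one that comes from \<open>gap_sum\<close> is positive.\<close>

lemma double_zeta_nonzero:
  assumes a2: "1 / 2 \<le> a" and s: "0 < s1" "1 < s2" "s1 + s2 < 2"
  shows "double_zeta a (of_real s1, of_real s2) \<noteq> 0"
proof -
  obtain S where S: "double_zeta_num a (of_real s1, of_real s2) =
      of_real (Re (zeta_num a (of_real (s1 + s2 - 1))) + (2 - s1 - s2) * S)" "0 < S"
    using double_zeta_num_real[OF s(1,2)] by blast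
  have "0 \<le> Re (zeta_num a (of_real (s1 + s2 - 1)))"
    using s by (intro zeta_num_nonneg_of_half_le a2) auto
  moreover have "0 < (2 - s1 - s2) * S" using S(2) s by simp
  ultimately have "Re (zeta_num a (of_real (s1 + s2 - 1))) + (2 - s1 - s2) * S \<noteq> 0" by simp
  then have "double_zeta_num a (of_real s1, of_real s2) \<noteq> 0"
    unfolding S(1) of_real_eq_0_iff .
  moreover have "complex_of_real s1 + of_real s2 - 2 = of_real (s1 + s2 - 2)"
    "complex_of_real s2 - 1 = of_real (s2 - 1)" by simp_all
  then have "complex_of_real s1 + of_real s2 - 2 \<noteq> 0" "complex_of_real s2 - 1 \<noteq> 0"
    using s by (simp_all only: of_real_eq_0_iff)
  ultimately show ?thesis by (simp add: double_zeta_def)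
qed

text \<open>Along \<open>(u - \<epsilon>, 1 + \<epsilon>)\<close> the exponent \<open>w\<close> is \<open>u\<close>, and \<open>gap_sum\<close> is \<open>O(\<epsilon>)\<close> at fixed \<open>u\<close>.  For small \<open>\<epsilon>\<close> the numerator
  has the sign of \<open>zeta_num a u0 < 0\<close> at \<open>u0 = 1/2 - a\<close>, while at \<open>u1 = 1 - a\<close> it is a sum
  of nonnegative terms.  The intermediate value theorem gives a zero between them.\<close>

lemma double_zeta_has_zero:
  assumes a2: "a < 1 / 2"
  obtains s1 s2 where "0 < s1" "s1 < 1" "1 < s2" "s1 + s2 < 2"
    "double_zeta a (of_real s1, of_real s2) = 0"
proof -
  define u0 u1 where "u0 = 1 / 2 - a" and "u1 = 1 - a"
  have u: "0 < u0" "u0 < u1" "u1 < 1" using a a2 by (auto simp: u0_def u1_def)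
  define Z where "Z u = Re (zeta_num a (of_real u))" for u
  have Z0: "Z u0 < 0" unfolding Z_def using u by (intro zeta_num_neg) (auto simp: u0_def)
  have Z1: "0 \<le> Z u1" unfolding Z_def using u by (intro zeta_num_nonneg_of_le) (auto simp: u1_def)
  define K where "K = (\<Sum>m. (real m + a) powr (- (u0 + 1)))"
  have K: "0 \<le> K"
    unfolding K_def using summable_pdiff[of a "u0 + 1" 0] a u
    by (intro suminf_nonneg) (auto simp: add.commute)
  \<comment> \<open>\<open>\<epsilon> < u0\<close> keeps \<open>s1 = u - \<epsilon>\<close> positive on the whole segment.\<close>
  define \<epsilon> where "\<epsilon> = min (u0 / 2) (- Z u0 / (K + 2))"
  have \<epsilon>: "0 < \<epsilon>" "\<epsilon> < u0" "\<epsilon> * (K + 1) < - Z u0"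
  proof -
    show e0: "0 < \<epsilon>" "\<epsilon> < u0"
      using u Z0 K by (auto simp: \<epsilon>_def intro!: divide_neg_pos)
    have "\<epsilon> \<le> - Z u0 / (K + 2)" by (simp add: \<epsilon>_def)
    then have "\<epsilon> * (K + 2) \<le> - Z u0" using K by (subst (asm) pos_le_divide_eq) auto
    then show "\<epsilon> * (K + 1) < - Z u0" using e0(1) by (simp add: algebra_simps)
  qed
  define l where "l u = (complex_of_real (u - \<epsilon>), complex_of_real (1 + \<epsilon>))" for u
  define f where "f u = Re (double_zeta_num a (l u))" for u
  have num: "\<exists>S. double_zeta_num a (l u) = of_real (Z u + (1 - u) * S) \<and> 0 < S \<and>
      S \<le> \<epsilon> * (\<Sum>m. (real m + a) powr (- (u + 1)))" if "u0 \<le> u" for u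
  proof -
    have "0 < u - \<epsilon>" "1 < 1 + \<epsilon>" using that \<epsilon> by auto
    then obtain S where "double_zeta_num a (of_real (u - \<epsilon>), of_real (1 + \<epsilon>)) =
        of_real (Re (zeta_num a (of_real (u - \<epsilon> + (1 + \<epsilon>) - 1))) + (2 - (u - \<epsilon>) - (1 + \<epsilon>)) * S)" "0 < S"
        "S \<le> (1 + \<epsilon> - 1) * (\<Sum>m. (real m + a) powr (- (u - \<epsilon> + (1 + \<epsilon>))))"
      by (rule double_zeta_num_real)
    moreover have "u - \<epsilon> + (1 + \<epsilon>) - 1 = u" "2 - (u - \<epsilon>) - (1 + \<epsilon>) = 1 - u" "1 + \<epsilon> - 1 = \<epsilon>"
      "u - \<epsilon> + (1 + \<epsilon>) = u + 1" by simp_all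
    ultimately show ?thesis unfolding l_def Z_def by metis
  qed
  have "f u0 \<le> 0"
  proof -
    obtain S where S: "double_zeta_num a (l u0) = of_real (Z u0 + (1 - u0) * S)" "0 < S" "S \<le> \<epsilon> * K"
      using num[of u0] unfolding K_def by auto
    have "(1 - u0) * S \<le> 1 * (\<epsilon> * K)"
      using S u \<epsilon> K by (intro mult_mono) auto
    also have "\<dots> \<le> \<epsilon> * (K + 1)" using \<epsilon> by (simp add: algebra_simps)
    finally show ?thesis using \<epsilon>(3) by (simp add: f_def S(1))
  qed
  moreover have "0 \<le> f u1"
  proof -
    obtain S where "double_zeta_num a (l u1) = of_real (Z u1 + (1 - u1) * S)" "0 < S"
      using num[of u1] u by auto
    then show ?thesis using Z1 u by (simp add: f_def)
  qed
  moreover have "continuous_on {u0..u1} f"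
  proof -
    have "continuous_on (l ` {u0..u1}) (double_zeta_num a)"
      by (rule continuous_on_subset[OF holomorphic2_on_imp_continuous_on
            [OF holomorphic2_on_double_zeta_num[OF a]]])
        (use \<epsilon> in \<open>auto simp: l_def half_spaces_def\<close>)
    moreover have "continuous_on {u0..u1} l"
      unfolding l_def by (intro continuous_intros)
    ultimately show ?thesis
      unfolding f_def by (intro continuous_intros) (rule continuous_on_compose2[OF _ _ order_refl])
  qed
  ultimately obtain u where u': "u0 \<le> u" "u \<le> u1" "f u = 0"
    using IVT'[of f u0 0 u1] u by auto
  obtain S where S: "double_zeta_num a (l u) = of_real (Z u + (1 - u) * S)"
    using num[OF u'(1)] by blast
  have "double_zeta_num a (l u) = 0"
    using u'(3) unfolding f_def S Re_complex_of_real by (simp only: of_real_0)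
  then have "double_zeta a (of_real (u - \<epsilon>), of_real (1 + \<epsilon>)) = 0"
    by (simp add: double_zeta_def l_def)
  then show thesis
    using u u' \<epsilon> by (intro that[of "u - \<epsilon>" "1 + \<epsilon>"]) auto
qed

end

theorem theorem1p4:
  fixes a :: real and z1 z2 :: complex
  assumes "0 < a" "a \<le> 1"
    and "0 < norm z1" "norm z1 \<le> 1"
    and "0 < norm z2" "norm z2 \<le> 1"
  shows "(z1 = 1 \<and> z2 = 1 \<longrightarrow>
            ((\<forall>\<sigma>1 \<sigma>2 :: real. 0 < \<sigma>1 \<and> \<sigma>1 < 1 \<and> 1 < \<sigma>2 \<and> 1 < \<sigma>1 + \<sigma>2 \<and> \<sigma>1 + \<sigma>2 < 2 \<longrightarrow>
                Phi2 (of_real \<sigma>1) (of_real \<sigma>2) a z1 z2 \<noteq> 0) \<longleftrightarrow> 1 / 2 \<le> a)) \<and>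
         (z1 = 1 \<and> z2 \<noteq> 1 \<longrightarrow>
            (\<forall>\<sigma>1 \<sigma>2 :: real. 1 < \<sigma>1 \<and> 0 < \<sigma>2 \<longrightarrow>
                Phi2 (of_real \<sigma>1) (of_real \<sigma>2) a z1 z2 \<noteq> 0)) \<and>
         (z1 \<noteq> 1 \<and> z2 = 1 \<longrightarrow>
            (\<forall>\<sigma>1 \<sigma>2 :: real. 0 < \<sigma>1 \<and> 1 < \<sigma>2 \<longrightarrow>
                Phi2 (of_real \<sigma>1) (of_real \<sigma>2) a z1 z2 \<noteq> 0)) \<and>
         (z1 \<noteq> 1 \<and> z2 \<noteq> 1 \<longrightarrow>
            (\<forall>\<sigma>1 \<sigma>2 :: real. 0 < \<sigma>1 \<and> 0 < \<sigma>2 \<longrightarrow>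
                Phi2 (of_real \<sigma>1) (of_real \<sigma>2) a z1 z2 \<noteq> 0))"
proof -
  have z: "z1 \<noteq> 0" "norm z1 \<le> 1" "z2 \<noteq> 0" "norm z2 \<le> 1" using assms by auto
  have abel: "Phi2 (of_real \<sigma>1) (of_real \<sigma>2) a z1 z2 \<noteq> 0"
    if "abscissa z1 < \<sigma>1" "abscissa z2 < \<sigma>2" for \<sigma>1 \<sigma>2
    using that Phi2_eq_double_sum[OF assms(1) z] double_sum_nonzero[OF assms(1) z] by simp
  have zeta: "Phi2 (of_real \<sigma>1) (of_real \<sigma>2) a 1 1 = double_zeta a (of_real \<sigma>1, of_real \<sigma>2)"
    if "0 < \<sigma>1" "1 < \<sigma>2" "\<sigma>1 + \<sigma>2 < 2" for \<sigma>1 \<sigma>2 :: real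
  proof (rule Phi2_eq_double_zeta[OF assms(1)])
    show "complex_of_real \<sigma>1 + of_real \<sigma>2 \<noteq> 2"
      using that by (simp add: complex_eq_iff)
  qed (use that in auto)
  have "(\<forall>\<sigma>1 \<sigma>2 :: real. 0 < \<sigma>1 \<and> \<sigma>1 < 1 \<and> 1 < \<sigma>2 \<and> 1 < \<sigma>1 + \<sigma>2 \<and> \<sigma>1 + \<sigma>2 < 2 \<longrightarrow>
          Phi2 (of_real \<sigma>1) (of_real \<sigma>2) a 1 1 \<noteq> 0) \<longleftrightarrow> 1 / 2 \<le> a"
  proof
    assume nz: "\<forall>\<sigma>1 \<sigma>2 :: real. 0 < \<sigma>1 \<and> \<sigma>1 < 1 \<and> 1 < \<sigma>2 \<and> 1 < \<sigma>1 + \<sigma>2 \<and> \<sigma>1 + \<sigma>2 < 2 \<longrightarrow>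
          Phi2 (of_real \<sigma>1) (of_real \<sigma>2) a 1 1 \<noteq> 0"
    show "1 / 2 \<le> a"
    proof (rule ccontr)
      assume "\<not> 1 / 2 \<le> a"
      then have "a < 1 / 2" by simp
      then obtain s1 s2 where s: "0 < s1" "s1 < 1" "1 < s2" "s1 + s2 < 2"
          "double_zeta a (of_real s1, of_real s2) = 0"
        by (rule double_zeta_has_zero[OF assms(1)])
      then show False using nz[rule_format, of s1 s2] zeta[of s1 s2] by auto
    qed
  next
    assume "1 / 2 \<le> a"
    then show "\<forall>\<sigma>1 \<sigma>2 :: real. 0 < \<sigma>1 \<and> \<sigma>1 < 1 \<and> 1 < \<sigma>2 \<and> 1 < \<sigma>1 + \<sigma>2 \<and> \<sigma>1 + \<sigma>2 < 2 \<longrightarrow>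
          Phi2 (of_real \<sigma>1) (of_real \<sigma>2) a 1 1 \<noteq> 0"
      using zeta double_zeta_nonzero[OF assms(1)] by simp
  qed
  then show ?thesis
    using abel by (intro conjI impI) (simp_all add: abscissa_def)
qed

end
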